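(* Let $T$ be a consistent recursively enumerable (RE) theory. Then the following are equivalent: (1) $T$ is Rosser; (2) $T$ is effectively Rosser; (3) $T$ is exact Rosser; (4) $T$ is effectively exact Rosser.
   Context: A fixed Gödel numbering of formulas is used; $\ulcorner\phi\urcorner$ is the code of $\phi$. ${\sf Num}$ is the theory in the language $\{\mathbf 0,\mathbf S\}$ whose axioms are $\overline m\neq\overline n$ for all $m\neq n$, where $\overline 0=\mathbf 0$ and $\overline{k+1}=\mathbf S\overline k$. An interpretation $I:{\sf Num}\unlhd T$ is a translation of the language of ${\sf Num}$ into that of $T$ (a domain formula $\delta_I$ and formulas translating $=$, $\mathbf 0$, $\mathbf S$) such that $T$ proves totality of the translated function symbols on $\delta_I$, the translations of all theorems of ${\sf Num}$ and of the equality axioms. $\overline a^I$ denotes the $I$-translation of the numeral $\overline a$, and $\phi(\overline{a_1}^I,\dots,\overline{a_n}^I)$ the corresponding $T$-formula. If $T$ is a relational extension of ${\sf Num}$, $I$ is taken to be the identity. $\langle R^n_i:i\in\omega\rangle$ is an acceptable enumeration of all $n$-ary RE relations. For $n$-ary relations $M_1,M_2$, a formula $\phi(x_1,\dots,x_n)$ with exactly $n$ free variables strongly separates $M_1$ from $M_2$ in $T$ w.r.t. $I$ if for all $\vec a=(a_1,\dots,a_n)$: $\vec a\in M_1\Rightarrow T\vdash\phi(\overline{a_1}^I,\dots,\overline{a_n}^I)$ and $\vec a\in M_2\Rightarrow T\vdash\neg\phi(\overline{a_1}^I,\dots,\overline{a_n}^I)$; for disjoint $M_1,M_2$ it exactly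 separates them if both implications are equivalences. $T$ is $n$-Rosser if there is $I:{\sf Num}\unlhd T$ such that for every pair of $n$-ary RE relations $M_1,M_2$ some formula strongly separates $M_1\setminus M_2$ from $M_2\setminus M_1$ w.r.t. $I$. $T$ is exact $n$-Rosser if there is $I$ such that every disjoint pair of $n$-ary RE relations is exactly separated by some formula w.r.t. $I$. $T$ is effectively $n$-Rosser if there are $I$ and a recursive $f$ such that for all $i,j$, $f(i,j)$ is the code of a formula with exactly $n$ free variables strongly separating $R^n_i\setminus R^n_j$ from $R^n_j\setminus R^n_i$ w.r.t. $I$. $T$ is effectively exact $n$-Rosser if there are $I$ and a recursive $f$ such that for all $i,j$ with $R^n_i\cap R^n_j=\emptyset$, $f(i,j)$ codes a formula with exactly $n$ free variables exactly separating $R^n_i$ from $R^n_j$ w.r.t. $I$. $T$ is Rosser (resp. effectively Rosser, exact Rosser, effectively exact Rosser) if it is $n$-Rosser (resp. effectively $n$-Rosser, exact $n$-Rosser, effectively exact $n$-Rosser) for every $n\geq1$; the interpretation may depend on $n$. *)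

theory Defs
  imports Main "HOL-Library.Nat_Bijection"
begin

section \<open>First-order logic with equality\<close>

text \<open>Variables are de Bruijn indices. A function (relation) symbol is a pair of a name and an
  arity; in a term or atom the arity is the number of arguments.\<close>

datatype tm = Var nat | Fun nat "tm list"

datatype fm = Bot | Eq tm tm | Rel nat "tm list" | Imp fm fm | All fm

abbreviation Neg :: "fm \<Rightarrow> fm" where "Neg \<phi> \<equiv> Imp \<phi> Bot"
abbreviation And :: "fm \<Rightarrow> fm \<Rightarrow> fm" where "And \<phi> \<psi> \<equiv> Neg (Imp \<phi> (Neg \<psi>))"
abbreviation Ex :: "fm \<Rightarrow> fm" where "Ex \<phi> \<equiv> Neg (All (Neg \<phi>))"

fun tfv :: "tm \<Rightarrow> nat set" where
  "tfv (Var i) = {i}"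
| "tfv (Fun f ts) = (\<Union>t\<in>set ts. tfv t)"

fun fv :: "fm \<Rightarrow> nat set" where
  "fv Bot = {}"
| "fv (Eq s t) = tfv s \<union> tfv t"
| "fv (Rel r ts) = (\<Union>t\<in>set ts. tfv t)"
| "fv (Imp \<phi> \<psi>) = fv \<phi> \<union> fv \<psi>"
| "fv (All \<phi>) = {i. Suc i \<in> fv \<phi>}"

fun tsubst :: "(nat \<Rightarrow> tm) \<Rightarrow> tm \<Rightarrow> tm" where
  "tsubst \<sigma> (Var i) = \<sigma> i"
| "tsubst \<sigma> (Fun f ts) = Fun f (map (tsubst \<sigma>) ts)"

abbreviation tlift :: "tm \<Rightarrow> tm" where "tlift \<equiv> tsubst (\<lambda>i. Var (Suc i))"

fun subst :: "(nat \<Rightarrow> tm) \<Rightarrow> fm \<Rightarrow> fm" where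
  "subst \<sigma> Bot = Bot"
| "subst \<sigma> (Eq s t) = Eq (tsubst \<sigma> s) (tsubst \<sigma> t)"
| "subst \<sigma> (Rel r ts) = Rel r (map (tsubst \<sigma>) ts)"
| "subst \<sigma> (Imp \<phi> \<psi>) = Imp (subst \<sigma> \<phi>) (subst \<sigma> \<psi>)"
| "subst \<sigma> (All \<phi>) = All (subst (case_nat (Var 0) (\<lambda>i. tlift (\<sigma> i))) \<phi>)"

abbreviation lift :: "fm \<Rightarrow> fm" where "lift \<equiv> subst (\<lambda>i. Var (Suc i))"

text \<open>\<open>inst t \<phi>\<close> removes the outermost variable 0 in favour of \<open>t\<close>, shifting the others down;
  \<open>app \<phi> [t\<^sub>0, \<dots>, t\<^sub>k]\<close> replaces the variables 0 to k simultaneously, without shifting.\<close>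

definition inst :: "tm \<Rightarrow> fm \<Rightarrow> fm" where
  "inst t = subst (case_nat t Var)"

definition app :: "fm \<Rightarrow> tm list \<Rightarrow> fm" where
  "app \<phi> ts = subst (\<lambda>i. if i < length ts then ts ! i else Var i) \<phi>"

record signature =
  funs :: "(nat \<times> nat) set"
  rels :: "(nat \<times> nat) set"

fun wf_tm :: "signature \<Rightarrow> tm \<Rightarrow> bool" where
  "wf_tm L (Var i) = True"
| "wf_tm L (Fun f ts) = ((f, length ts) \<in> funs L \<and> (\<forall>t\<in>set ts. wf_tm L t))"

fun wf_fm :: "signature \<Rightarrow> fm \<Rightarrow> bool" where
  "wf_fm L Bot = True"
| "wf_fm L (Eq s t) = (wf_tm L s \<and> wf_tm L t)"
| "wf_fm L (Rel r ts) = ((r, length ts) \<in> rels L \<and> (\<forall>t\<in>set ts. wf_tm L t))"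
| "wf_fm L (Imp \<phi> \<psi>) = (wf_fm L \<phi> \<and> wf_fm L \<psi>)"
| "wf_fm L (All \<phi>) = wf_fm L \<phi>"

definition sentence :: "signature \<Rightarrow> fm \<Rightarrow> bool" where
  "sentence L \<phi> \<longleftrightarrow> wf_fm L \<phi> \<and> fv \<phi> = {}"

text \<open>A Hilbert calculus for theories, i.e. sets \<open>T\<close> of sentences (axioms); generalization is
  unrestricted because the members of \<open>T\<close> are closed. Derivations may mention symbols
  foreign to \<open>T\<close>; as usual this is conservative.\<close>

inductive proves :: "fm set \<Rightarrow> fm \<Rightarrow> bool" (infix \<open>\<turnstile>\<close> 50)
  for T :: "fm set" where
  Axiom: "\<phi> \<in> T \<Longrightarrow> T \<turnstile> \<phi>"
| MP: "T \<turnstile> Imp \<phi> \<psi> \<Longrightarrow> T \<turnstile> \<phi> \<Longrightarrow> T \<turnstile> \<psi>"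
| Gen: "T \<turnstile> \<phi> \<Longrightarrow> T \<turnstile> All \<phi>"
| K: "T \<turnstile> Imp \<phi> (Imp \<psi> \<phi>)"
| S: "T \<turnstile> Imp (Imp \<phi> (Imp \<psi> \<chi>)) (Imp (Imp \<phi> \<psi>) (Imp \<phi> \<chi>))"
| DN: "T \<turnstile> Imp (Neg (Neg \<phi>)) \<phi>"
| All_imp: "T \<turnstile> Imp (All (Imp \<phi> \<psi>)) (Imp (All \<phi>) (All \<psi>))"
| All_vacuous: "T \<turnstile> Imp \<phi> (All (lift \<phi>))"
| All_inst: "T \<turnstile> Imp (All \<phi>) (inst t \<phi>)"
| Eq_refl: "T \<turnstile> Eq t t"
| Eq_Leibniz: "T \<turnstile> Imp (Eq s t) (Imp (inst s \<phi>) (inst t \<phi>))"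

definition consistent :: "fm set \<Rightarrow> bool" where
  "consistent T \<longleftrightarrow> \<not> T \<turnstile> Bot"


section \<open>Recursive functions and RE relations\<close>

text \<open>Only the values of \<open>f\<close> on lists of length \<open>n\<close> matter in \<open>recursive n f\<close> (rule \<open>cong_on\<close>).
  Minimization is restricted to regular functions, so that only total functions occur.\<close>

inductive recursive :: "nat \<Rightarrow> (nat list \<Rightarrow> nat) \<Rightarrow> bool" where
  zero: "recursive n (\<lambda>xs. 0)"
| succ: "recursive 1 (\<lambda>xs. Suc (xs ! 0))"
| proj: "i < n \<Longrightarrow> recursive n (\<lambda>xs. xs ! i)"
| comp: "recursive (length hs) g \<Longrightarrow> (\<forall>h\<in>set hs. recursive n h) \<Longrightarrow>
    recursive n (\<lambda>xs. g (map (\<lambda>h. h xs) hs))"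
| prim_rec: "recursive n f \<Longrightarrow> recursive (Suc (Suc n)) g \<Longrightarrow>
    recursive (Suc n) (\<lambda>xs. rec_nat (f (tl xs)) (\<lambda>k r. g (k # r # tl xs)) (hd xs))"
| mu: "recursive (Suc n) f \<Longrightarrow> (\<forall>xs. length xs = n \<longrightarrow> (\<exists>k. f (k # xs) = 0)) \<Longrightarrow>
    recursive n (\<lambda>xs. LEAST k. f (k # xs) = 0)"
| cong_on: "recursive n f \<Longrightarrow> (\<forall>xs. length xs = n \<longrightarrow> g xs = f xs) \<Longrightarrow> recursive n g"

text \<open>An \<open>n\<close>-ary relation is a set of lists of length \<open>n\<close>. It is RE if it is the projection of a
  recursive \<open>(n + 1)\<close>-ary relation.\<close>

definition re :: "nat \<Rightarrow> nat list set \<Rightarrow> bool" where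
  "re n M \<longleftrightarrow> (\<forall>xs\<in>M. length xs = n) \<and>
     (\<exists>f. recursive (Suc n) f \<and> (\<forall>xs. length xs = n \<longrightarrow> (xs \<in> M \<longleftrightarrow> (\<exists>k. f (k # xs) = 0))))"

text \<open>\<open>R n i\<close> is the \<open>i\<close>-th \<open>n\<close>-ary RE relation. Acceptability is the enumeration theorem
  together with the iteration (s-m-n) theorem.\<close>

definition acceptable_enumeration :: "(nat \<Rightarrow> nat \<Rightarrow> nat list set) \<Rightarrow> bool" where
  "acceptable_enumeration R \<longleftrightarrow>
     (\<forall>n\<ge>1. range (R n) = {M. re n M}) \<and>
     (\<forall>n\<ge>1. re (Suc n) {i # xs | i xs. xs \<in> R n i}) \<and>
     (\<forall>m\<ge>1. \<forall>n\<ge>1. \<exists>s. recursive (Suc m) s \<and>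
        (\<forall>e ys. length ys = m \<longrightarrow>
           R n (s (e # ys)) = {xs. length xs = n \<and> ys @ xs \<in> R (m + n) e}))"


section \<open>Goedel numbering and RE theories\<close>

fun code_tm :: "tm \<Rightarrow> nat" where
  "code_tm (Var i) = prod_encode (0, i)"
| "code_tm (Fun f ts) = prod_encode (1, prod_encode (f, list_encode (map code_tm ts)))"

fun code :: "fm \<Rightarrow> nat" where
  "code Bot = prod_encode (0, 0)"
| "code (Eq s t) = prod_encode (1, prod_encode (code_tm s, code_tm t))"
| "code (Rel r ts) = prod_encode (2, prod_encode (r, list_encode (map code_tm ts)))"
| "code (Imp \<phi> \<psi>) = prod_encode (3, prod_encode (code \<phi>, code \<psi>))"
| "code (All \<phi>) = prod_encode (4, code \<phi>)"

text \<open>A theory is given by any RE set of axioms; a deductively closed set is a special case.\<close>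

definition re_theory :: "signature \<Rightarrow> fm set \<Rightarrow> bool" where
  "re_theory L T \<longleftrightarrow> (\<forall>\<phi>\<in>T. sentence L \<phi>) \<and> re 1 {[code \<phi>] | \<phi>. \<phi> \<in> T}"


section \<open>The theory Num and its interpretations\<close>

abbreviation Zero :: tm where "Zero \<equiv> Fun 0 []"
abbreviation Succ :: "tm \<Rightarrow> tm" where "Succ t \<equiv> Fun 1 [t]"

fun numeral_tm :: "nat \<Rightarrow> tm" where
  "numeral_tm 0 = Zero"
| "numeral_tm (Suc k) = Succ (numeral_tm k)"

definition Num_sig :: signature where
  "Num_sig = \<lparr>funs = {(0, 0), (1, 1)}, rels = {}\<rparr>"

definition Num :: "fm set" where
  "Num = {Neg (Eq (numeral_tm m) (numeral_tm n)) | m n. m \<noteq> n}"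

text \<open>A translation of the language of Num: \<open>tr_dom\<close> has free variable 0, \<open>tr_eq\<close> has 0 and 1,
  \<open>tr_zero\<close> (the graph of the constant) has 0, and \<open>tr_succ\<close> (the graph of the successor) has
  0 for the argument and 1 for the value.\<close>

record translation =
  tr_dom :: fm
  tr_eq :: fm
  tr_zero :: fm
  tr_succ :: fm

definition translation_into :: "signature \<Rightarrow> translation \<Rightarrow> bool" where
  "translation_into L I \<longleftrightarrow>
     wf_fm L (tr_dom I) \<and> fv (tr_dom I) \<subseteq> {0} \<and>
     wf_fm L (tr_eq I) \<and> fv (tr_eq I) \<subseteq> {0, 1} \<and>
     wf_fm L (tr_zero I) \<and> fv (tr_zero I) \<subseteq> {0} \<and>
     wf_fm L (tr_succ I) \<and> fv (tr_succ I) \<subseteq> {0, 1}"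

lemma size_tsubst_Var [simp]: "size (tsubst (\<lambda>i. Var (f i)) t) = size t"
  by (induction t) (auto intro!: size_list_pointwise simp: o_def size_list_conv_sum_list cong: map_cong)

text \<open>\<open>graph I t y\<close> translates the equation between \<open>t\<close> and the variable \<open>y\<close>. Function symbols are
  first brought into the positions \<open>0 = y\<close> and \<open>S x = y\<close> with variables \<open>x\<close>, \<open>y\<close> by naming the
  values of compound arguments with new existential quantifiers. Expressions outside the
  language of Num are never translated and get a dummy value.\<close>

fun graph :: "translation \<Rightarrow> tm \<Rightarrow> nat \<Rightarrow> fm" where
  "graph I (Var x) y = app (tr_eq I) [Var x, Var y]"
| "graph I (Fun f []) y = app (tr_zero I) [Var y]"
| "graph I (Fun f [Var x]) y = app (tr_succ I) [Var x, Var y]"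
| "graph I (Fun f [t]) y =
     Ex (And (tr_dom I) (And (graph I (tlift t) 0) (app (tr_succ I) [Var 0, Var (Suc y)])))"
| "graph I (Fun f (s # t # ts)) y = Bot"

fun translate_eq :: "translation \<Rightarrow> tm \<Rightarrow> tm \<Rightarrow> fm" where
  "translate_eq I s (Var y) = graph I s y"
| "translate_eq I (Var x) t = graph I t x"
| "translate_eq I s t = Ex (And (tr_dom I) (And (graph I (tlift s) 0) (graph I (tlift t) 0)))"

fun translate :: "translation \<Rightarrow> fm \<Rightarrow> fm" where
  "translate I Bot = Bot"
| "translate I (Eq s t) = translate_eq I s t"
| "translate I (Rel r ts) = Bot"
| "translate I (Imp \<phi> \<psi>) = Imp (translate I \<phi>) (translate I \<psi>)"
| "translate I (All \<phi>) = All (Imp (tr_dom I) (translate I \<phi>))"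

definition Num_eq_axioms :: "fm set" where
  "Num_eq_axioms =
     {All (Eq (Var 0) (Var 0)),
      All (All (Imp (Eq (Var 1) (Var 0)) (Eq (Var 0) (Var 1)))),
      All (All (All (Imp (Eq (Var 2) (Var 1)) (Imp (Eq (Var 1) (Var 0)) (Eq (Var 2) (Var 0)))))),
      All (All (Imp (Eq (Var 1) (Var 0)) (Eq (Succ (Var 1)) (Succ (Var 0)))))}"

definition interprets_Num :: "signature \<Rightarrow> fm set \<Rightarrow> translation \<Rightarrow> bool" where
  "interprets_Num L T I \<longleftrightarrow> translation_into L I \<and>
     T \<turnstile> Ex (And (tr_dom I) (tr_zero I)) \<and>
     T \<turnstile> All (Imp (tr_dom I) (Ex (And (tr_dom I) (app (tr_succ I) [Var 1, Var 0])))) \<and>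
     (\<forall>\<phi>. sentence Num_sig \<phi> \<and> Num \<turnstile> \<phi> \<longrightarrow> T \<turnstile> translate I \<phi>) \<and>
     (\<forall>\<phi>\<in>Num_eq_axioms. T \<turnstile> translate I \<phi>)"

definition relational_extension_of_Num :: "signature \<Rightarrow> fm set \<Rightarrow> bool" where
  "relational_extension_of_Num L T \<longleftrightarrow> funs L = funs Num_sig \<and> (\<forall>\<phi>\<in>Num. T \<turnstile> \<phi>)"

definition id_translation :: translation where
  "id_translation =
     \<lparr>tr_dom = Eq (Var 0) (Var 0), tr_eq = Eq (Var 0) (Var 1),
      tr_zero = Eq Zero (Var 0), tr_succ = Eq (Succ (Var 0)) (Var 1)\<rparr>"

text \<open>The interpretations of Num that are admitted in the Rosser notions: for relational extensions
  of Num only the identity.\<close>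

definition Num_interp :: "signature \<Rightarrow> fm set \<Rightarrow> translation \<Rightarrow> bool" where
  "Num_interp L T I \<longleftrightarrow> interprets_Num L T I \<and>
     (relational_extension_of_Num L T \<longrightarrow> I = id_translation)"


section \<open>Separation and the Rosser properties\<close>

text \<open>The variables \<open>x\<^sub>1, \<dots>, x\<^sub>n\<close> are the indices 0 to n - 1.\<close>

definition formula_in :: "signature \<Rightarrow> nat \<Rightarrow> fm \<Rightarrow> bool" where
  "formula_in L n \<phi> \<longleftrightarrow> wf_fm L \<phi> \<and> fv \<phi> = {..<n}"

text \<open>The formula \<open>\<phi>\<close> at the translated numerals of \<open>as\<close>, that is
  \<open>\<exists>x\<^sub>1 \<dots> x\<^sub>n. \<delta>(x\<^sub>1) \<and> (a\<^sub>1 = x\<^sub>1)\<^sup>I \<and> \<dots> \<and> \<delta>(x\<^sub>n) \<and> (a\<^sub>n = x\<^sub>n)\<^sup>I \<and> \<phi>(x\<^sub>1, \<dots>, x\<^sub>n)\<close>.\<close>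

definition at_numerals :: "translation \<Rightarrow> fm \<Rightarrow> nat list \<Rightarrow> fm" where
  "at_numerals I \<phi> as =
     (Ex ^^ length as)
       (foldr And
         (map (\<lambda>i. And (app (tr_dom I) [Var i]) (graph I (numeral_tm (as ! i)) i)) [0..<length as])
         \<phi>)"

definition strongly_separates ::
  "fm set \<Rightarrow> translation \<Rightarrow> nat \<Rightarrow> fm \<Rightarrow> nat list set \<Rightarrow> nat list set \<Rightarrow> bool" where
  "strongly_separates T I n \<phi> M1 M2 \<longleftrightarrow>
     (\<forall>as. length as = n \<longrightarrow>
        (as \<in> M1 \<longrightarrow> T \<turnstile> at_numerals I \<phi> as) \<and>
        (as \<in> M2 \<longrightarrow> T \<turnstile> Neg (at_numerals I \<phi> as)))"

definition exactly_separates ::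
  "fm set \<Rightarrow> translation \<Rightarrow> nat \<Rightarrow> fm \<Rightarrow> nat list set \<Rightarrow> nat list set \<Rightarrow> bool" where
  "exactly_separates T I n \<phi> M1 M2 \<longleftrightarrow>
     (\<forall>as. length as = n \<longrightarrow>
        (as \<in> M1 \<longleftrightarrow> T \<turnstile> at_numerals I \<phi> as) \<and>
        (as \<in> M2 \<longleftrightarrow> T \<turnstile> Neg (at_numerals I \<phi> as)))"

definition n_Rosser :: "signature \<Rightarrow> fm set \<Rightarrow> nat \<Rightarrow> bool" where
  "n_Rosser L T n \<longleftrightarrow> (\<exists>I. Num_interp L T I \<and>
     (\<forall>M1 M2. re n M1 \<and> re n M2 \<longrightarrow>
        (\<exists>\<phi>. formula_in L n \<phi> \<and> strongly_separates T I n \<phi> (M1 - M2) (M2 - M1))))"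

definition exact_n_Rosser :: "signature \<Rightarrow> fm set \<Rightarrow> nat \<Rightarrow> bool" where
  "exact_n_Rosser L T n \<longleftrightarrow> (\<exists>I. Num_interp L T I \<and>
     (\<forall>M1 M2. re n M1 \<and> re n M2 \<and> M1 \<inter> M2 = {} \<longrightarrow>
        (\<exists>\<phi>. formula_in L n \<phi> \<and> exactly_separates T I n \<phi> M1 M2)))"

definition effectively_n_Rosser ::
  "(nat \<Rightarrow> nat \<Rightarrow> nat list set) \<Rightarrow> signature \<Rightarrow> fm set \<Rightarrow> nat \<Rightarrow> bool" where
  "effectively_n_Rosser R L T n \<longleftrightarrow> (\<exists>I f. Num_interp L T I \<and> recursive 2 f \<and>
     (\<forall>i j. \<exists>\<phi>. f [i, j] = code \<phi> \<and> formula_in L n \<phi> \<and>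
        strongly_separates T I n \<phi> (R n i - R n j) (R n j - R n i)))"

definition effectively_exact_n_Rosser ::
  "(nat \<Rightarrow> nat \<Rightarrow> nat list set) \<Rightarrow> signature \<Rightarrow> fm set \<Rightarrow> nat \<Rightarrow> bool" where
  "effectively_exact_n_Rosser R L T n \<longleftrightarrow> (\<exists>I f. Num_interp L T I \<and> recursive 2 f \<and>
     (\<forall>i j. R n i \<inter> R n j = {} \<longrightarrow>
        (\<exists>\<phi>. f [i, j] = code \<phi> \<and> formula_in L n \<phi> \<and>
           exactly_separates T I n \<phi> (R n i) (R n j))))"

definition Rosser :: "signature \<Rightarrow> fm set \<Rightarrow> bool" where
  "Rosser L T \<longleftrightarrow> (\<forall>n\<ge>1. n_Rosser L T n)"

definition effectively_Rosser ::
  "(nat \<Rightarrow> nat \<Rightarrow> nat list set) \<Rightarrow> signature \<Rightarrow> fm set \<Rightarrow> bool" where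
  "effectively_Rosser R L T \<longleftrightarrow> (\<forall>n\<ge>1. effectively_n_Rosser R L T n)"

definition exact_Rosser :: "signature \<Rightarrow> fm set \<Rightarrow> bool" where
  "exact_Rosser L T \<longleftrightarrow> (\<forall>n\<ge>1. exact_n_Rosser L T n)"

definition effectively_exact_Rosser ::
  "(nat \<Rightarrow> nat \<Rightarrow> nat list set) \<Rightarrow> signature \<Rightarrow> fm set \<Rightarrow> bool" where
  "effectively_exact_Rosser R L T \<longleftrightarrow> (\<forall>n\<ge>1. effectively_exact_n_Rosser R L T n)"

end

theory Submission
  imports Defs
begin

text \<open>Everything reduces to one step: a Rosser theory is effectively exact Rosser. Apply the Rosser
  property in arity \<open>n + 3\<close> to the relations
  \<open>M\<^sub>1 = {(e, i, j, x). x \<in> R\<^sub>i \<or> T \<turnstile> \<not> \<phi>\<^sub>e(e, i, j, x)}\<close> and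
  \<open>M\<^sub>2 = {(e, i, j, x). x \<in> R\<^sub>j \<or> T \<turnstile> \<phi>\<^sub>e(e, i, j, x)}\<close>, where \<open>\<phi>\<^sub>e\<close> is the formula with code \<open>e\<close>;
  they are RE because \<open>T\<close> is. If \<open>\<phi>\<close> strongly separates \<open>M\<^sub>1 - M\<^sub>2\<close> from \<open>M\<^sub>2 - M\<^sub>1\<close> and \<open>e\<close> is its own
  code, then by consistency \<open>\<phi>(e, i, j, x)\<close> is provable exactly when \<open>x \<in> R\<^sub>i\<close> and refutable exactly
  when \<open>x \<in> R\<^sub>j\<close>, for disjoint \<open>R\<^sub>i\<close> and \<open>R\<^sub>j\<close>; its code is recursive in \<open>i\<close> and \<open>j\<close>. The same relations
  without the provability clauses make a Rosser theory effectively Rosser. An exact Rosser theory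
  is Rosser since any two RE relations can be reduced to disjoint ones.\<close>

section \<open>Closure properties of recursive functions\<close>

text \<open>The form of \<open>comp\<close> used throughout: the composite has to agree with
  \<open>g\<close> only on lists of length \<open>n\<close>, the only ones that
  \<open>recursive n g\<close> constrains.\<close>

lemma recursive_comp_map:
  assumes "recursive m f" "length hs = m" "\<And>h. h \<in> set hs \<Longrightarrow> recursive n h"
    and "\<And>xs. length xs = n \<Longrightarrow> g xs = f (map (\<lambda>h. h xs) hs)"
  shows "recursive n g"
  using comp[of hs f n] assms by (auto intro: cong_on)

text \<open>Permuting, repeating or dropping arguments is composition with projections.\<close>

lemma recursive_select:
  assumes "recursive (length is) f" "\<forall>i\<in>set is. i < n"
  shows "recursive n (\<lambda>xs. f (map ((!) xs) is))"
  by (rule recursive_comp_map[of _ f "map (\<lambda>i xs. xs ! i) is"])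
    (use assms in \<open>auto intro: proj simp: o_def\<close>)

lemma recursive_Cons:
  assumes "recursive (Suc n) F" "recursive n a"
  shows "recursive n (\<lambda>xs. F (a xs # xs))"
proof (rule recursive_comp_map[OF assms(1), of "a # map (\<lambda>i xs. xs ! i) [0..<n]"])
  fix xs :: "nat list" assume "length xs = n"
  then show "F (a xs # xs) = F (map (\<lambda>h. h xs) (a # map (\<lambda>i xs. xs ! i) [0..<n]))"
    by (auto simp: o_def intro!: arg_cong[where f=F] nth_equalityI)
qed (use assms in \<open>auto intro: proj\<close>)

lemma map_nth_drop: "length xs = n \<Longrightarrow> map ((!) xs) [k..<n] = drop k xs"
  by (rule nth_equalityI) auto

lemma recursive_tl:
  assumes "recursive n f" shows "recursive (Suc n) (\<lambda>xs. f (tl xs))"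
proof -
  have "recursive (Suc n) (\<lambda>xs. f (map ((!) xs) [Suc 0..<Suc n]))"
    by (rule recursive_select) (use assms in \<open>auto simp del: upt_Suc\<close>)
  then show ?thesis
    by (rule cong_on) (simp add: map_nth_drop drop_Suc del: upt_Suc)
qed

lemma recursive_const: "recursive n (\<lambda>xs. c)"
proof (induction c)
  case (Suc c)
  show ?case by (rule recursive_comp_map[OF succ, of "[\<lambda>xs. c]"]) (use Suc in auto)
qed (rule zero)

lemma recursive_1:
  assumes "recursive 1 f" "recursive n a"
  shows "recursive n (\<lambda>xs. f [a xs])"
  by (rule recursive_comp_map[OF assms(1), of "[a]"]) (use assms in auto)

lemma recursive_2:
  assumes "recursive 2 f" "recursive n a" "recursive n b"
  shows "recursive n (\<lambda>xs. f [a xs, b xs])"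
  by (rule recursive_comp_map[OF assms(1), of "[a, b]"]) (use assms in auto)

text \<open>\<open>prim_rec\<close> recurses on the head of the argument list. Putting
  \<open>a xs\<close> in front of the parameters makes the number of steps any recursive function of
  them.\<close>

lemma recursive_rec_nat:
  assumes "recursive n a" "recursive n f"
    and "recursive (Suc (Suc n)) (\<lambda>ys. G (ys ! 0) (ys ! 1) (tl (tl ys)))"
  shows "recursive n (\<lambda>xs. rec_nat (f xs) (\<lambda>k r. G k r xs) (a xs))"
  using recursive_Cons[OF prim_rec[OF assms(2,3)] assms(1)] by simp

lemma recursive_Least:
  assumes "recursive (Suc n) (\<lambda>ys. F (ys ! 0) (tl ys))"
    and "\<And>xs. length xs = n \<Longrightarrow> \<exists>k. F k xs = 0"
  shows "recursive n (\<lambda>xs. LEAST k. F k xs = 0)"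
  using mu[OF assms(1)] assms(2) by simp

lemma recursive_proj: "i < n \<Longrightarrow> recursive n (\<lambda>xs. xs ! i)"
  by (rule proj)

lemma recursive_Suc: "recursive n f \<Longrightarrow> recursive n (\<lambda>xs. Suc (f xs))"
  using recursive_1[OF succ] by simp

section \<open>Arithmetic functions and case distinction\<close>

lemma recursive_add:
  assumes "recursive n f" "recursive n g" shows "recursive n (\<lambda>xs. f xs + g xs)"
proof -
  have "recursive n (\<lambda>xs. rec_nat (f xs) (\<lambda>k r. Suc r) (g xs))"
    by (intro recursive_rec_nat assms recursive_Suc recursive_proj) simp
  moreover have "rec_nat a (\<lambda>k r. Suc r) b = a + b" for a b
    by (induction b) auto
  ultimately show ?thesis by simp
qed

lemma recursive_pred:
  assumes "recursive n f" shows "recursive n (\<lambda>xs. f xs - 1)"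
proof -
  have "recursive n (\<lambda>xs. rec_nat 0 (\<lambda>k r. k) (f xs))"
    by (intro recursive_rec_nat assms recursive_const recursive_proj) simp
  moreover have "rec_nat 0 (\<lambda>k r. k) b = b - 1" for b
    by (induction b) auto
  ultimately show ?thesis by simp
qed

lemma recursive_diff:
  assumes "recursive n f" "recursive n g" shows "recursive n (\<lambda>xs. f xs - g xs)"
proof -
  have "recursive n (\<lambda>xs. rec_nat (f xs) (\<lambda>k r. r - 1) (g xs))"
    by (intro recursive_rec_nat assms recursive_pred recursive_proj) simp
  moreover have "rec_nat a (\<lambda>k r. r - 1) b = a - b" for a b
    by (induction b) auto
  ultimately show ?thesis by simp
qed

lemma recursive_mult:
  assumes "recursive n f" "recursive n g" shows "recursive n (\<lambda>xs. f xs * g xs)"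
proof -
  have "recursive n (\<lambda>xs. rec_nat 0 (\<lambda>k r. r + f xs) (g xs))"
    by (intro recursive_rec_nat assms recursive_const recursive_add recursive_proj recursive_tl) simp
  moreover have "rec_nat 0 (\<lambda>k r. r + a) b = a * b" for a b
    by (induction b) auto
  ultimately show ?thesis by simp
qed

lemma recursive_if_0:
  assumes "recursive n f" "recursive n g" "recursive n h"
  shows "recursive n (\<lambda>xs. if f xs = 0 then g xs else h xs)"
proof -
  have "recursive n (\<lambda>xs. rec_nat (g xs) (\<lambda>k r. h xs) (f xs))"
    by (intro recursive_rec_nat assms recursive_tl)
  moreover have "rec_nat a (\<lambda>k r. b) c = (if c = 0 then a else b)" for a b :: nat and c
    by (cases c) auto
  ultimately show ?thesis by simp
qed

lemma recursive_mod_2: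
  assumes "recursive n f" shows "recursive n (\<lambda>xs. f xs mod 2)"
proof -
  have "recursive n (\<lambda>xs. rec_nat 0 (\<lambda>k r. 1 - r) (f xs))"
    by (intro recursive_rec_nat assms recursive_const recursive_diff recursive_proj) simp
  moreover have "rec_nat 0 (\<lambda>k r. 1 - r) b = b mod 2" for b :: nat
  proof (induction b)
    case (Suc b)
    then show ?case by simp presburger
  qed simp
  ultimately show ?thesis by simp
qed

lemma recursive_div_2:
  assumes "recursive n f" shows "recursive n (\<lambda>xs. f xs div 2)"
proof -
  \<comment> \<open>Halving is primitive recursive because
    \<open>Suc k div 2 = k - k div 2\<close>.\<close>
  have "recursive n (\<lambda>xs. rec_nat 0 (\<lambda>k r. k - r) (f xs))"
    by (intro recursive_rec_nat assms recursive_const recursive_diff recursive_proj) simp_all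
  moreover have "rec_nat 0 (\<lambda>k r. k - r) b = b div 2" for b :: nat
  proof (induction b)
    case (Suc b)
    then show ?case by simp
  qed simp
  ultimately show ?thesis by simp
qed

lemma recursive_power_2:
  assumes "recursive n f" shows "recursive n (\<lambda>xs. 2 ^ f xs)"
proof -
  have "recursive n (\<lambda>xs. rec_nat 1 (\<lambda>k r. 2 * r) (f xs))"
    by (intro recursive_rec_nat assms recursive_const recursive_mult recursive_proj) simp_all
  moreover have "rec_nat 1 (\<lambda>k r. 2 * r) b = (2 :: nat) ^ b" for b
    by (induction b) auto
  ultimately show ?thesis by simp
qed

lemma recursive_div_power_2:
  assumes "recursive n f" "recursive n g" shows "recursive n (\<lambda>xs. f xs div 2 ^ g xs)"
proof -
  have "recursive n (\<lambda>xs. rec_nat (f xs) (\<lambda>k r. r div 2) (g xs))"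
    by (intro recursive_rec_nat assms recursive_div_2 recursive_proj) simp_all
  moreover have "rec_nat a (\<lambda>k r. r div 2) b = a div 2 ^ b" for a b :: nat
    by (induction b) (auto simp: div_mult2_eq[symmetric] mult.commute)
  ultimately show ?thesis by simp
qed

lemma recursive_triangle:
  assumes "recursive n f" shows "recursive n (\<lambda>xs. triangle (f xs))"
proof -
  have "recursive n (\<lambda>xs. rec_nat 0 (\<lambda>k r. r + Suc k) (f xs))"
    by (intro recursive_rec_nat assms recursive_const recursive_add recursive_Suc recursive_proj) simp_all
  moreover have "rec_nat 0 (\<lambda>k r. r + Suc k) b = triangle b" for b
    by (induction b) auto
  ultimately show ?thesis by simp
qed

lemma recursive_prod_encode:
  assumes "recursive n f" "recursive n g" shows "recursive n (\<lambda>xs. prod_encode (f xs, g xs))"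
  unfolding prod_encode_def by (simp, intro assms recursive_add recursive_triangle)

section \<open>Inverting the Cantor pairing function\<close>

lemma triangle_strict_mono: "i < j \<Longrightarrow> triangle i + i < triangle j"
  by (induction j) (auto simp: less_Suc_eq)

text \<open>Pairs with sum \<open>s\<close> are coded by the block of numbers from
  \<open>triangle s\<close> to \<open>triangle s + s\<close>. The truncated difference vanishes
  exactly when the code lies below \<open>triangle (Suc k)\<close>, so the least such
  \<open>k\<close> is the index of its block.\<close>

lemma triangle_root_prod_encode:
  "(LEAST k. Suc (prod_encode (a, b)) - triangle (Suc k) = 0) = a + b"
proof (rule Least_equality)
  fix k assume k: "Suc (prod_encode (a, b)) - triangle (Suc k) = 0"
  show "a + b \<le> k"
  proof (rule ccontr)
    assume "\<not> a + b \<le> k"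
    then have "Suc k = a + b \<or> triangle (Suc k) + Suc k < triangle (a + b)"
      using triangle_strict_mono[of "Suc k" "a + b"] by linarith
    then have "triangle (Suc k) \<le> triangle (a + b)" by (metis add_leD1 le_refl less_imp_le)
    then show False using k by (simp add: prod_encode_def)
  qed
qed (simp add: prod_encode_def)

lemma recursive_triangle_root:
  assumes "recursive n f"
  shows "recursive n (\<lambda>xs. LEAST k. Suc (f xs) - triangle (Suc k) = 0)"
proof (rule recursive_Least)
  show "recursive (Suc n) (\<lambda>ys. Suc (f (tl ys)) - triangle (Suc (ys ! 0)))"
    by (intro assms recursive_diff recursive_Suc recursive_triangle recursive_tl recursive_proj) simp
  show "\<exists>k. Suc (f xs) - triangle (Suc k) = 0" for xs
    by (rule exI[of _ "f xs"]) simp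
qed

lemma recursive_fst_prod_decode:
  assumes "recursive n f" shows "recursive n (\<lambda>xs. fst (prod_decode (f xs)))"
proof -
  have "fst (prod_decode z) = z - triangle (LEAST k. Suc z - triangle (Suc k) = 0)" for z
  proof -
    obtain a b where "z = prod_encode (a, b)" by (metis prod_decode_inverse surj_pair)
    then show ?thesis by (simp only: triangle_root_prod_encode) (simp, simp add: prod_encode_def)
  qed
  then show ?thesis
    by (simp only:) (intro recursive_diff recursive_triangle recursive_triangle_root assms)
qed

lemma recursive_snd_prod_decode:
  assumes "recursive n f" shows "recursive n (\<lambda>xs. snd (prod_decode (f xs)))"
proof -
  have "snd (prod_decode z) = (LEAST k. Suc z - triangle (Suc k) = 0) - fst (prod_decode z)" for z
  proof -
    obtain a b where "z = prod_encode (a, b)" by (metis prod_decode_inverse surj_pair)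
    then show ?thesis by (simp only: triangle_root_prod_encode) simp
  qed
  then show ?thesis
    by (simp only:) (intro recursive_diff recursive_triangle_root recursive_fst_prod_decode assms)
qed

lemmas recursive_intros =
  recursive_proj recursive_const recursive_Suc recursive_add recursive_diff recursive_mult
  recursive_if_0 recursive_mod_2 recursive_power_2 recursive_div_power_2 recursive_prod_encode
  recursive_fst_prod_decode recursive_snd_prod_decode

subsection \<open>The reduction property of RE relations\<close>

text \<open>Search for witnesses of both memberships in parallel: a tuple goes to the side whose
  witness appears first, and ties go to \<open>N1\<close>.\<close>

lemma re_reduction:
  assumes "re n M1" "re n M2"
  obtains N1 N2 where "re n N1" "re n N2" "N1 \<inter> N2 = {}" "M1 - M2 \<subseteq> N1" "M2 - M1 \<subseteq> N2"
proof -
  obtain f where f: "recursive (Suc n) f" 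
    "\<And>xs. length xs = n \<Longrightarrow> xs \<in> M1 \<longleftrightarrow> (\<exists>k. f (k # xs) = 0)" and M1: "\<forall>xs\<in>M1. length xs = n"
    using assms(1) unfolding re_def by blast
  obtain g where g: "recursive (Suc n) g"
    "\<And>xs. length xs = n \<Longrightarrow> xs \<in> M2 \<longleftrightarrow> (\<exists>k. g (k # xs) = 0)" and M2: "\<forall>xs\<in>M2. length xs = n"
    using assms(2) unfolding re_def by blast
  \<comment> \<open>A bounded product: it vanishes iff \<open>h\<close> has a witness for
    \<open>xs\<close> below \<open>k\<close>.\<close>
  define below where "below h k xs = rec_nat 1 (\<lambda>i r. r * h (i # xs)) k"
    for h :: "nat list \<Rightarrow> nat" and k xs
  have below_0: "below h k xs = 0 \<longleftrightarrow> (\<exists>i<k. h (i # xs) = 0)" for h k xs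
    by (induction k) (auto simp: below_def less_Suc_eq)
  have nz: "a + (1 - b) = 0 \<longleftrightarrow> a = 0 \<and> b \<noteq> 0" for a b :: nat by auto
  have rec_below: "recursive (Suc n) (\<lambda>ys. below h (a ys) (tl ys))"
    if "recursive (Suc n) h" "recursive (Suc n) a" for h a
  proof -
    \<comment> \<open>The arguments are the counter, the accumulator and then \<open>ys\<close>,
      whose own head is discarded.\<close>
    have *: "recursive (Suc (Suc (Suc n))) (\<lambda>ys. h (ys ! 0 # tl (tl (tl ys))))"
    proof -
      have "recursive (Suc (Suc (Suc n))) (\<lambda>xs. h (map ((!) xs) (0 # [3..<n+3])))"
        by (rule recursive_select) (use that in \<open>auto simp del: upt_Suc\<close>)
      then show ?thesis
        by (rule cong_on) (auto simp: map_nth_drop numeral_3_eq_3 drop_Suc simp del: upt_Suc)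
    qed
    have "recursive (Suc n) (\<lambda>ys. rec_nat 1 (\<lambda>i r. r * h (i # tl ys)) (a ys))"
      by (intro recursive_rec_nat recursive_intros that *) simp
    then show ?thesis by (simp add: below_def)
  qed
  define N1 where "N1 = {xs. length xs = n \<and> (\<exists>k. f (k # xs) + (1 - below g k xs) = 0)}"
  \<comment> \<open>A sum vanishes iff both summands do, and \<open>1 - b\<close> vanishes iff
    \<open>b\<close> does not. The bound \<open>Suc k\<close>, against \<open>k\<close> in
    \<open>N1\<close>, denies \<open>N2\<close> the ties and makes the two sets disjoint.\<close>
  define N2 where "N2 = {xs. length xs = n \<and> (\<exists>k. g (k # xs) + (1 - below f (Suc k) xs) = 0)}"
  have "recursive (Suc n) (\<lambda>ys. f ys + (1 - below g (ys ! 0) (tl ys)))"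
    by (intro recursive_intros rec_below f g) simp
  then have "re n N1" unfolding re_def N1_def by fastforce
  moreover have "recursive (Suc n) (\<lambda>ys. g ys + (1 - below f (Suc (ys ! 0)) (tl ys)))"
    by (intro recursive_intros rec_below f g) simp
  then have "re n N2" unfolding re_def N2_def by fastforce
  moreover have mem1: "xs \<in> N1 \<longleftrightarrow> length xs = n \<and> (\<exists>k. f (k # xs) = 0 \<and> (\<forall>i<k. g (i # xs) \<noteq> 0))"
    and mem2: "xs \<in> N2 \<longleftrightarrow> length xs = n \<and> (\<exists>k. g (k # xs) = 0 \<and> (\<forall>i\<le>k. f (i # xs) \<noteq> 0))" for xs
    by (simp_all only: N1_def N2_def mem_Collect_eq nz below_0 less_Suc_eq_le not_ex de_Morgan_conj
        imp_conv_disj)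
  have "N1 \<inter> N2 = {}"
  proof (rule ccontr)
    assume "N1 \<inter> N2 \<noteq> {}"
    then obtain xs k l where "f (k # xs) = 0" "\<forall>i<k. g (i # xs) \<noteq> 0"
      "g (l # xs) = 0" "\<forall>i\<le>l. f (i # xs) \<noteq> 0"
      using mem1 mem2 by blast
    then show False by (meson leI)
  qed
  moreover have "xs \<in> N1" if "xs \<in> M1 - M2" for xs
    using that M1 f(2)[of xs] g(2)[of xs] mem1[of xs] by auto
  then have "M1 - M2 \<subseteq> N1" by blast
  moreover have "xs \<in> N2" if "xs \<in> M2 - M1" for xs
    using that M2 f(2)[of xs] g(2)[of xs] mem2[of xs] by auto
  then have "M2 - M1 \<subseteq> N2" by blast
  ultimately show thesis using that by blast
qed

section \<open>Least sets closed under recursive rules are RE\<close>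

text \<open>A rule consists of two premises and a conclusion, each computed from the same
  \<open>n\<close> parameters. The fact \<open>0\<close> comes for free and can fill a premise
  slot.\<close>

inductive_set horn :: "nat \<Rightarrow> ((nat list \<Rightarrow> nat) \<times> (nat list \<Rightarrow> nat) \<times> (nat list \<Rightarrow> nat)) list \<Rightarrow> nat set"
  for n rs where
  horn_0: "0 \<in> horn n rs"
| horn_step: "(p, q, c) \<in> set rs \<Longrightarrow> length xs = n \<Longrightarrow> p xs \<in> horn n rs \<Longrightarrow> q xs \<in> horn n rs \<Longrightarrow>
    c xs \<in> horn n rs"

text \<open>Iterated unpairing reads every number as an infinite sequence, so parameter lists of any
  length can be extracted without storing the length.\<close>

fun param :: "nat \<Rightarrow> nat \<Rightarrow> nat" where
  "param z 0 = fst (prod_decode z)"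
| "param z (Suc i) = param (snd (prod_decode z)) i"

lemma recursive_param: "recursive n f \<Longrightarrow> recursive n (\<lambda>xs. param (f xs) i)"
  by (induction i arbitrary: f) (simp_all add: recursive_fst_prod_decode recursive_snd_prod_decode)

text \<open>The innermost tail of the nested pairs is free and a pair is at least its second
  component, so the code can be made as large as desired. This lets a rule fire after its premises
  have appeared.\<close>

lemma param_surj: "\<exists>s\<ge>N. \<forall>i<length xs. param s i = xs ! i"
proof (induction xs)
  case (Cons x xs)
  then obtain s where s: "s \<ge> N" "\<forall>i<length xs. param s i = xs ! i" by blast
  have "\<forall>i<length (x # xs). param (prod_encode (x, s)) i = (x # xs) ! i"
    using s(2) by (auto simp: less_Suc_eq_0_disj)
  moreover have "N \<le> prod_encode (x, s)" using s(1) le_prod_encode_2 order_trans by blast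
  ultimately show ?case by blast
qed auto

section \<open>Finite sets as binary numbers and the stages of a Horn system\<close>

definition nat_member :: "nat \<Rightarrow> nat \<Rightarrow> nat" where
  "nat_member x A = (A div 2 ^ x) mod 2"

definition nat_insert :: "nat \<Rightarrow> nat \<Rightarrow> nat" where
  "nat_insert x A = (if nat_member x A = 0 then A + 2 ^ x else A)"

lemma nat_member_0_iff: "nat_member x A = 0 \<longleftrightarrow> x \<notin> set_decode A"
  by (simp add: nat_member_def set_decode_def even_iff_mod_2_eq_zero)

lemma set_decode_nat_insert: "set_decode (nat_insert x A) = insert x (set_decode A)"
proof (cases "x \<in> set_decode A")
  case False
  then have "nat_insert x A = set_encode (insert x (set_decode A))"
    by (simp add: nat_insert_def nat_member_0_iff set_encode_insert)
  then show ?thesis by simp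
qed (auto simp: nat_insert_def nat_member_0_iff)

definition horn_rule :: "nat list \<Rightarrow> (nat list \<Rightarrow> nat) \<times> (nat list \<Rightarrow> nat) \<times> (nat list \<Rightarrow> nat) \<Rightarrow> nat \<Rightarrow> nat" where
  "horn_rule xs = (\<lambda>(p, q, c) A.
     if nat_member (p xs) A * nat_member (q xs) A = 0 then A else nat_insert (c xs) A)"

text \<open>Finite sets are coded in binary. Stage \<open>s\<close> fires each rule once, at the parameters coded
  by \<open>s\<close>; each parameter list is coded by arbitrarily large \<open>s\<close>.\<close>

definition horn_stage ::
  "nat \<Rightarrow> ((nat list \<Rightarrow> nat) \<times> (nat list \<Rightarrow> nat) \<times> (nat list \<Rightarrow> nat)) list \<Rightarrow> nat \<Rightarrow> nat" where
  "horn_stage n rs = rec_nat 1 (\<lambda>s A. fold (horn_rule (map (param s) [0..<n])) rs A)"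

lemma set_decode_horn_rule:
  "set_decode (horn_rule xs (p, q, c) A) =
     set_decode A \<union> (if p xs \<in> set_decode A \<and> q xs \<in> set_decode A then {c xs} else {})"
  using nat_member_0_iff[of "p xs" A] nat_member_0_iff[of "q xs" A]
  by (auto simp: horn_rule_def set_decode_nat_insert)

lemma fold_horn_rule_mono: "set_decode A \<subseteq> set_decode (fold (horn_rule xs) rs A)"
proof (induction rs arbitrary: A)
  case (Cons r rs)
  obtain p q c where "r = (p, q, c)" by (cases r)
  then have "set_decode A \<subseteq> set_decode (horn_rule xs r A)" by (simp add: set_decode_horn_rule)
  then show ?case using Cons[of "horn_rule xs r A"] by auto
qed simp

lemma fold_horn_rule_fires:
  assumes "(p, q, c) \<in> set rs" "p xs \<in> set_decode A" "q xs \<in> set_decode A"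
  shows "c xs \<in> set_decode (fold (horn_rule xs) rs A)"
  using assms
proof (induction rs arbitrary: A)
  case (Cons r rs)
  show ?case
  proof (cases "r = (p, q, c)")
    case True
    then have "c xs \<in> set_decode (horn_rule xs r A)" using Cons by (simp add: set_decode_horn_rule)
    then show ?thesis using fold_horn_rule_mono by fastforce
  next
    case False
    have "set_decode A \<subseteq> set_decode (horn_rule xs r A)" by (cases r) (simp add: set_decode_horn_rule)
    then show ?thesis using Cons False by auto
  qed
qed simp

lemma fold_horn_rule_sound:
  assumes "set_decode A \<subseteq> horn n rs" "set ss \<subseteq> set rs" "length xs = n"
  shows "set_decode (fold (horn_rule xs) ss A) \<subseteq> horn n rs"
  using assms
proof (induction ss arbitrary: A)
  case (Cons r ss)
  obtain p q c where r: "r = (p, q, c)" by (cases r)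
  have "set_decode (horn_rule xs r A) \<subseteq> horn n rs"
    using Cons.prems by (auto simp: r set_decode_horn_rule intro: horn_step)
  then show ?case using Cons by auto
qed simp

lemma mono_horn_stage: "s \<le> s' \<Longrightarrow> set_decode (horn_stage n rs s) \<subseteq> set_decode (horn_stage n rs s')"
proof (induction s' rule: dec_induct)
  case (step s')
  then show ?case using fold_horn_rule_mono by (fastforce simp: horn_stage_def)
qed simp

lemma horn_stage_sound: "set_decode (horn_stage n rs s) \<subseteq> horn n rs"
proof (induction s)
  case 0
  \<comment> \<open>Stage 0 is the number \<open>1\<close>, the binary code of the set containing
    just \<open>0\<close>.\<close>
  have "set_decode (set_encode {0}) = {0}" by (rule set_encode_inverse) simp
  then have "set_decode 1 = {0}" by (simp add: set_encode_def)
  then show ?case by (simp add: horn_stage_def horn_0)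
next
  case (Suc s)
  then show ?case by (simp add: horn_stage_def fold_horn_rule_sound)
qed

lemma horn_stage_complete: "x \<in> horn n rs \<Longrightarrow> \<exists>s. x \<in> set_decode (horn_stage n rs s)"
proof (induction rule: horn.induct)
  case horn_0
  have "0 \<in> set_decode (horn_stage n rs 0)" by (simp add: horn_stage_def set_decode_def)
  then show ?case by blast
next
  case (horn_step p q c xs)
  then obtain s t where "p xs \<in> set_decode (horn_stage n rs s)" "q xs \<in> set_decode (horn_stage n rs t)"
    by blast
  \<comment> \<open>A stage that codes the parameters and at which both premises are already
    present; the rule fires on the way to \<open>Suc u\<close>.\<close>
  moreover obtain u where u: "u \<ge> max s t" "\<forall>i<length xs. param u i = xs ! i"
    using param_surj by blast
  ultimately have "p xs \<in> set_decode (horn_stage n rs u)" "q xs \<in> set_decode (horn_stage n rs u)"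
    using mono_horn_stage by (meson in_mono max.bounded_iff)+
  moreover have "map (param u) [0..<n] = xs"
    using u horn_step by (auto intro: nth_equalityI)
  ultimately have "c xs \<in> set_decode (horn_stage n rs (Suc u))"
    using fold_horn_rule_fires[OF horn_step(1)] by (simp add: horn_stage_def)
  then show ?case by blast
qed

lemma recursive_nat_member:
  "recursive n f \<Longrightarrow> recursive n g \<Longrightarrow> recursive n (\<lambda>xs. nat_member (f xs) (g xs))"
  unfolding nat_member_def by (intro recursive_intros)

lemma recursive_nat_insert:
  "recursive n f \<Longrightarrow> recursive n g \<Longrightarrow> recursive n (\<lambda>xs. nat_insert (f xs) (g xs))"
  unfolding nat_insert_def by (intro recursive_intros recursive_nat_member)

text \<open>The list of rules is fixed, so one stage is a finite composition, treated by induction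
  on the list. The sequence of stages is then a primitive recursion.\<close>

lemma recursive_horn_stage:
  assumes rec: "\<And>p q c. (p, q, c) \<in> set rs \<Longrightarrow> recursive n p \<and> recursive n q \<and> recursive n c"
    and f: "recursive m f"
  shows "recursive m (\<lambda>xs. horn_stage n rs (f xs))"
proof -
  have "recursive k (\<lambda>ys. fold (horn_rule (map (param (a ys)) [0..<n])) ss (b ys))"
    if "recursive k a" "recursive k b" "set ss \<subseteq> set rs" for k a b ss
    using that
  proof (induction ss arbitrary: b)
    case (Cons r ss)
    obtain p q c where r: "r = (p, q, c)" by (cases r)
    have "recursive k (\<lambda>ys. g (map (param (a ys)) [0..<n]))" if "recursive n g" for g
      by (rule recursive_comp_map[OF that, of "map (\<lambda>i ys. param (a ys) i) [0..<n]"])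
        (use Cons.prems in \<open>auto intro: recursive_param simp: o_def\<close>)
    then have "recursive k (\<lambda>ys. horn_rule (map (param (a ys)) [0..<n]) r (b ys))"
      using rec[of p q c] Cons.prems unfolding r horn_rule_def prod.case
      by (intro recursive_intros recursive_nat_member recursive_nat_insert) auto
    from Cons.IH[OF _ this] show ?case using Cons.prems by simp
  qed simp
  note fold = this
  show ?thesis unfolding horn_stage_def
    by (intro recursive_rec_nat f recursive_const fold recursive_proj) auto
qed

text \<open>The witness of membership is a stage at which the number is present; \<open>1 -\<close>
  turns presence into a zero.\<close>

lemma re_horn:
  assumes "\<And>p q c. (p, q, c) \<in> set rs \<Longrightarrow> recursive n p \<and> recursive n q \<and> recursive n c"
  shows "re 1 {[x] | x. x \<in> horn n rs}"
proof -
  let ?f = "\<lambda>ys. 1 - nat_member (ys ! 1) (horn_stage n rs (ys ! 0))"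
  have "recursive (Suc 1) ?f"
    by (intro recursive_diff recursive_const recursive_nat_member recursive_horn_stage assms
        recursive_proj) simp_all
  moreover have "1 - nat_member x A = 0 \<longleftrightarrow> x \<in> set_decode A" for x A
    using nat_member_0_iff[of x A] by (auto simp: nat_member_def)
  then have "x \<in> horn n rs \<longleftrightarrow> (\<exists>s. ?f [s, x] = 0)" for x
    using horn_stage_sound[of n rs] horn_stage_complete[of x n rs] by auto
  then have "\<forall>xs. length xs = 1 \<longrightarrow> (xs \<in> {[x] | x. x \<in> horn n rs} \<longleftrightarrow> (\<exists>s. ?f (s # xs) = 0))"
    by (simp only: length_Suc_conv One_nat_def length_0_conv) blast
  ultimately show ?thesis unfolding re_def by (intro conjI exI[where x = ?f]) auto
qed

section \<open>The theorems of an RE theory are RE\<close>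

lemma list_decode_member_less: "x \<in> set (list_decode n) \<Longrightarrow> x < n"
proof (induction n rule: list_decode.induct)
  case (2 n)
  obtain a b where n: "n = prod_encode (a, b)" by (metis prod_decode_inverse surj_pair)
  then have "x = a \<or> x \<in> set (list_decode b)" using 2(2) by simp
  moreover have "a \<le> n" "b \<le> n" by (auto simp: n le_prod_encode_1 le_prod_encode_2)
  moreover have "x \<in> set (list_decode b) \<Longrightarrow> x < b"
    using 2(1)[of a b] n by simp
  ultimately show ?case by auto
qed simp

text \<open>A nonzero tag makes a code larger than its body, which is why the decoding functions
  below terminate.\<close>

lemma less_prod_encode_Suc: "n < prod_encode (Suc k, n)"
  by (induction k) (auto simp: prod_encode_def)

lemma fst_prod_decode_le: "fst (prod_decode n) \<le> n"
  by (metis le_prod_encode_1 prod.collapse prod_decode_inverse)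

lemma snd_prod_decode_le: "snd (prod_decode n) \<le> n"
  by (metis le_prod_encode_2 prod.collapse prod_decode_inverse)

lemma snd_prod_decode_less: "fst (prod_decode n) \<noteq> 0 \<Longrightarrow> snd (prod_decode n) < n"
  by (metis less_prod_encode_Suc not0_implies_Suc prod.collapse prod_decode_inverse)

text \<open>Total decoding functions, so that the arithmetized rules below are sound without
  checking that their parameters are codes.\<close>

function decode_tm :: "nat \<Rightarrow> tm" where
  "decode_tm n = (let (k, m) = prod_decode n in
     if k = 0 then Var m
     else let (f, l) = prod_decode m in Fun f (map decode_tm (list_decode l)))"
  by auto
termination
proof (relation "measure id")
  fix n x k m y f l z
  assume *: "x = prod_decode n" "(k, m) = x" "k \<noteq> 0" "y = prod_decode m" "(f, l) = y" "z \<in> set (list_decode l)"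
  have "z < l" using * list_decode_member_less by blast
  also have "l \<le> m" using * snd_prod_decode_le by (metis snd_conv)
  also have "m < n" using * snd_prod_decode_less by (metis fst_conv snd_conv)
  finally show "(z, n) \<in> measure id" by simp
qed simp

function decode_fm :: "nat \<Rightarrow> fm" where
  "decode_fm n = (let (k, m) = prod_decode n; (a, b) = prod_decode m in
     if k = 1 then Eq (decode_tm a) (decode_tm b)
     else if k = 2 then Rel a (map decode_tm (list_decode b))
     else if k = 3 then Imp (decode_fm a) (decode_fm b)
     else if k = 4 then All (decode_fm m)
     else Bot)"
  by auto
termination
proof (relation "measure id")
  fix n x k m y a b
  assume *: "x = prod_decode n" "(k, m) = x" "y = prod_decode m" "(a, b) = y" "k \<noteq> 1" "k \<noteq> 2" "k = 3"
  have "m < n" using * snd_prod_decode_less by (metis fst_conv snd_conv zero_neq_numeral)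
  moreover have "a \<le> m" "b \<le> m" using * fst_prod_decode_le snd_prod_decode_le by (metis fst_conv snd_conv)+
  ultimately show "(a, n) \<in> measure id" "(b, n) \<in> measure id" by auto
next
  fix n x k m y a b
  assume *: "x = prod_decode n" "(k, m) = x" "y = prod_decode m" "(a, b) = y" "k \<noteq> 1" "k \<noteq> 2" "k \<noteq> 3" "k = 4"
  have "m < n" using * snd_prod_decode_less by (metis fst_conv snd_conv zero_neq_numeral)
  then show "(m, n) \<in> measure id" by simp
qed simp

declare decode_tm.simps [simp del] decode_fm.simps [simp del]

lemma decode_tm_simps [simp]:
  "decode_tm (prod_encode (0, i)) = Var i"
  "decode_tm (prod_encode (Suc 0, prod_encode (f, l))) = Fun f (map decode_tm (list_decode l))"
  by (subst decode_tm.simps, simp)+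

lemma decode_fm_simps [simp]:
  "decode_fm (prod_encode (0, n)) = Bot"
  "decode_fm (prod_encode (Suc 0, prod_encode (a, b))) = Eq (decode_tm a) (decode_tm b)"
  "decode_fm (prod_encode (2, prod_encode (a, b))) = Rel a (map decode_tm (list_decode b))"
  "decode_fm (prod_encode (3, prod_encode (a, b))) = Imp (decode_fm a) (decode_fm b)"
  "decode_fm (prod_encode (4, a)) = All (decode_fm a)"
  by (subst decode_fm.simps, simp add: case_prod_unfold)+

lemma decode_code_tm [simp]: "decode_tm (code_tm t) = t"
  by (induction t) (auto intro: map_idI)

lemma decode_code [simp]: "decode_fm (code \<phi>) = \<phi>"
  by (induction \<phi>) (auto intro: map_idI)

text \<open>\<open>subst_code k m\<close> decodes to one of the substitutions used in the axioms, pushed under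
  \<open>k\<close> quantifiers: the shift if \<open>m = 0\<close>, and the instantiation of variable 0 by the term coded by
  \<open>m - 1\<close> otherwise.\<close>

fun subst_code :: "nat \<Rightarrow> nat \<Rightarrow> nat \<Rightarrow> tm" where
  "subst_code 0 0 = (\<lambda>i. Var (Suc i))"
| "subst_code 0 (Suc t) = case_nat (decode_tm t) Var"
| "subst_code (Suc k) m = case_nat (Var 0) (\<lambda>i. tlift (subst_code k m i))"

section \<open>Arithmetized substitution and provability\<close>

text \<open>One number packs facts of several kinds, so that a single Horn system derives them all:
  \<open>j\<close> is the kind, \<open>k\<close> and \<open>m\<close> select a substitution as in
  \<open>subst_code\<close>, \<open>a\<close> is the input and \<open>b\<close> the result.\<close>

definition judgement :: "nat \<Rightarrow> nat \<Rightarrow> nat \<Rightarrow> nat \<Rightarrow> nat \<Rightarrow> nat" where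
  "judgement j k m a b = prod_encode (j, prod_encode (k, prod_encode (m, prod_encode (a, b))))"

text \<open>The kinds 1 to 4 assert the value of the substitution at a variable, term, list of terms
  and formula; kind 5 asserts provability. Decoded objects are compared instead of codes, since
  different numbers may decode to the same object.\<close>

definition holds :: "fm set \<Rightarrow> nat \<Rightarrow> bool" where
  "holds T n \<longleftrightarrow> (\<forall>j k m a b. n = judgement j k m a b \<longrightarrow>
     (j = 1 \<longrightarrow> decode_tm b = subst_code k m a) \<and>
     (j = 2 \<longrightarrow> decode_tm b = tsubst (subst_code k m) (decode_tm a)) \<and>
     (j = 3 \<longrightarrow> map decode_tm (list_decode b) = map (tsubst (subst_code k m) \<circ> decode_tm) (list_decode a)) \<and>
     (j = 4 \<longrightarrow> decode_fm b = subst (subst_code k m) (decode_fm a)) \<and>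
     (j = 5 \<longrightarrow> T \<turnstile> decode_fm b))"

abbreviation "J_var \<equiv> judgement (Suc 0)"
abbreviation "J_tm \<equiv> judgement 2"
abbreviation "J_list \<equiv> judgement 3"
abbreviation "J_fm \<equiv> judgement 4"
abbreviation "J_thm \<equiv> judgement 5 0 0 0"

abbreviation "c_var i \<equiv> prod_encode (0, i)"
abbreviation "c_fun f l \<equiv> prod_encode (Suc 0, prod_encode (f, l))"
abbreviation "c_cons t l \<equiv> Suc (prod_encode (t, l))"
abbreviation "c_bot \<equiv> prod_encode (0, 0)"
abbreviation "c_eq s t \<equiv> prod_encode (Suc 0, prod_encode (s, t))"
abbreviation "c_rel r l \<equiv> prod_encode (2, prod_encode (r, l))"
abbreviation "c_imp a b \<equiv> prod_encode (3, prod_encode (a, b))"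
abbreviation "c_all a \<equiv> prod_encode (4, a)"
abbreviation "c_neg a \<equiv> c_imp a c_bot"

lemma judgement_inject [simp]:
  "judgement j k m a b = judgement j' k' m' a' b' \<longleftrightarrow> j = j' \<and> k = k' \<and> m = m' \<and> a = a' \<and> b = b'"
  by (simp add: judgement_def)

lemma judgement_0: "0 = judgement 0 0 0 0 0"
  by (simp add: judgement_def prod_encode_def)

lemma holds_simps [simp]:
  "holds T 0"
  "holds T (J_var k m a b) \<longleftrightarrow> decode_tm b = subst_code k m a"
  "holds T (J_tm k m a b) \<longleftrightarrow> decode_tm b = tsubst (subst_code k m) (decode_tm a)"
  "holds T (J_list k m a b) \<longleftrightarrow>
     map decode_tm (list_decode b) = map (tsubst (subst_code k m) \<circ> decode_tm) (list_decode a)"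
  "holds T (J_fm k m a b) \<longleftrightarrow> decode_fm b = subst (subst_code k m) (decode_fm a)"
  "holds T (J_thm b) \<longleftrightarrow> T \<turnstile> decode_fm b"
  by (subst judgement_0, simp add: holds_def del: One_nat_def) (simp_all add: holds_def)

text \<open>Premise slots that a rule does not need hold the trivial judgement \<open>0\<close>. The function \<open>ax\<close>
  semidecides the axioms of the theory.\<close>

definition proof_rules ::
  "(nat list \<Rightarrow> nat) \<Rightarrow> ((nat list \<Rightarrow> nat) \<times> (nat list \<Rightarrow> nat) \<times> (nat list \<Rightarrow> nat)) list" where
  "proof_rules ax = [
    (\<lambda>xs. 0, \<lambda>xs. 0, \<lambda>xs. J_var 0 0 (xs!0) (c_var (Suc (xs!0)))),
    (\<lambda>xs. 0, \<lambda>xs. 0, \<lambda>xs. J_var 0 (Suc (xs!0)) 0 (xs!0)),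
    (\<lambda>xs. 0, \<lambda>xs. 0, \<lambda>xs. J_var 0 (Suc (xs!0)) (Suc (xs!1)) (c_var (xs!1))),
    (\<lambda>xs. 0, \<lambda>xs. 0, \<lambda>xs. J_var (Suc (xs!0)) (xs!1) 0 (c_var 0)),
    (\<lambda>xs. J_var (xs!0) (xs!1) (xs!2) (xs!3), \<lambda>xs. J_tm 0 0 (xs!3) (xs!4),
      \<lambda>xs. J_var (Suc (xs!0)) (xs!1) (Suc (xs!2)) (xs!4)),
    (\<lambda>xs. J_var (xs!0) (xs!1) (xs!2) (xs!3), \<lambda>xs. 0,
      \<lambda>xs. J_tm (xs!0) (xs!1) (c_var (xs!2)) (xs!3)),
    (\<lambda>xs. J_list (xs!0) (xs!1) (xs!2) (xs!3), \<lambda>xs. 0,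
      \<lambda>xs. J_tm (xs!0) (xs!1) (c_fun (xs!4) (xs!2)) (c_fun (xs!4) (xs!3))),
    (\<lambda>xs. 0, \<lambda>xs. 0, \<lambda>xs. J_list (xs!0) (xs!1) 0 0),
    (\<lambda>xs. J_tm (xs!0) (xs!1) (xs!2) (xs!3), \<lambda>xs. J_list (xs!0) (xs!1) (xs!4) (xs!5),
      \<lambda>xs. J_list (xs!0) (xs!1) (c_cons (xs!2) (xs!4)) (c_cons (xs!3) (xs!5))),
    (\<lambda>xs. 0, \<lambda>xs. 0, \<lambda>xs. J_fm (xs!0) (xs!1) c_bot c_bot),
    (\<lambda>xs. J_tm (xs!0) (xs!1) (xs!2) (xs!3), \<lambda>xs. J_tm (xs!0) (xs!1) (xs!4) (xs!5),
      \<lambda>xs. J_fm (xs!0) (xs!1) (c_eq (xs!2) (xs!4)) (c_eq (xs!3) (xs!5))),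
    (\<lambda>xs. J_list (xs!0) (xs!1) (xs!2) (xs!3), \<lambda>xs. 0,
      \<lambda>xs. J_fm (xs!0) (xs!1) (c_rel (xs!4) (xs!2)) (c_rel (xs!4) (xs!3))),
    (\<lambda>xs. J_fm (xs!0) (xs!1) (xs!2) (xs!3), \<lambda>xs. J_fm (xs!0) (xs!1) (xs!4) (xs!5),
      \<lambda>xs. J_fm (xs!0) (xs!1) (c_imp (xs!2) (xs!4)) (c_imp (xs!3) (xs!5))),
    (\<lambda>xs. J_fm (Suc (xs!0)) (xs!1) (xs!2) (xs!3), \<lambda>xs. 0,
      \<lambda>xs. J_fm (xs!0) (xs!1) (c_all (xs!2)) (c_all (xs!3))),
    (\<lambda>xs. 0, \<lambda>xs. 0, \<lambda>xs. if ax [xs!0, xs!1] = 0 then J_thm (xs!1) else 0),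
    (\<lambda>xs. J_thm (c_imp (xs!0) (xs!1)), \<lambda>xs. J_thm (xs!0), \<lambda>xs. J_thm (xs!1)),
    (\<lambda>xs. J_thm (xs!0), \<lambda>xs. 0, \<lambda>xs. J_thm (c_all (xs!0))),
    (\<lambda>xs. 0, \<lambda>xs. 0, \<lambda>xs. J_thm (c_imp (xs!0) (c_imp (xs!1) (xs!0)))),
    (\<lambda>xs. 0, \<lambda>xs. 0, \<lambda>xs. J_thm (c_imp (c_imp (xs!0) (c_imp (xs!1) (xs!2)))
      (c_imp (c_imp (xs!0) (xs!1)) (c_imp (xs!0) (xs!2))))),
    (\<lambda>xs. 0, \<lambda>xs. 0, \<lambda>xs. J_thm (c_imp (c_neg (c_neg (xs!0))) (xs!0))),
    (\<lambda>xs. 0, \<lambda>xs. 0, \<lambda>xs. J_thm (c_imp (c_all (c_imp (xs!0) (xs!1)))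
      (c_imp (c_all (xs!0)) (c_all (xs!1))))),
    (\<lambda>xs. J_fm 0 0 (xs!0) (xs!1), \<lambda>xs. 0, \<lambda>xs. J_thm (c_imp (xs!0) (c_all (xs!1)))),
    (\<lambda>xs. J_fm 0 (Suc (xs!2)) (xs!0) (xs!1), \<lambda>xs. 0, \<lambda>xs. J_thm (c_imp (c_all (xs!0)) (xs!1))),
    (\<lambda>xs. 0, \<lambda>xs. 0, \<lambda>xs. J_thm (c_eq (xs!0) (xs!0))),
    (\<lambda>xs. J_fm 0 (Suc (xs!0)) (xs!2) (xs!3), \<lambda>xs. J_fm 0 (Suc (xs!1)) (xs!2) (xs!4),
      \<lambda>xs. J_thm (c_imp (c_eq (xs!0) (xs!1)) (c_imp (xs!3) (xs!4))))]"

text \<open>The rules for kinds 1 to 4 are the recursion equations of substitution, and those for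
  kind 5 are the clauses of \<open>proves\<close>, all read through decoding.\<close>

lemma proof_rules_sound:
  assumes ax: "\<And>k c. ax [k, c] = 0 \<Longrightarrow> \<exists>\<phi>\<in>T. c = code \<phi>"
  shows "n \<in> horn 6 (proof_rules ax) \<Longrightarrow> holds T n"
proof (induction rule: horn.induct)
  case (horn_step p q c xs)
  have ax_thm: "T \<turnstile> decode_fm c" if "ax [k, c] = 0" for k c
    using ax[OF that] by (auto intro: Axiom)
  \<comment> \<open>Unfolding the explicit list turns this into one goal per rule.\<close>
  have "list_all (\<lambda>(p, q, c). holds T (p xs) \<longrightarrow> holds T (q xs) \<longrightarrow> holds T (c xs)) (proof_rules ax)"
    unfolding proof_rules_def list.pred_inject prod.case One_nat_def
    by (auto simp: ax_thm comp_def simp flip: inst_def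
        intro: K S DN All_imp All_vacuous All_inst Eq_refl Eq_Leibniz Gen dest: MP)
  then show ?case using horn_step by (auto simp: list_all_iff)
qed simp


section \<open>Completeness of the arithmetized calculus\<close>

definition theorem_codes :: "(nat list \<Rightarrow> nat) \<Rightarrow> nat set" where
  "theorem_codes ax = horn 6 (proof_rules ax)"

lemma theorem_codes_0: "0 \<in> theorem_codes ax"
  by (simp add: theorem_codes_def horn_0)

text \<open>A rule is addressed by its position in \<open>proof_rules\<close>, counted from 0; the
  parameter lists supplied below are padded with zeros to length six.\<close>

lemma theorem_codes_step:
  assumes "i < length (proof_rules ax)" "length xs = 6"
    "fst (proof_rules ax ! i) xs \<in> theorem_codes ax"
    "fst (snd (proof_rules ax ! i)) xs \<in> theorem_codes ax"
  shows "snd (snd (proof_rules ax ! i)) xs \<in> theorem_codes ax"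
  using assms horn_step[of _ _ _ "proof_rules ax" xs 6]
  by (metis nth_mem prod.collapse theorem_codes_def)

lemmas theorem_codes_simps = proof_rules_def theorem_codes_0

lemma J_list_complete:
  assumes "\<And>t. t \<in> set ts \<Longrightarrow>
    J_tm k m (code_tm t) (code_tm (tsubst (subst_code k m) t)) \<in> theorem_codes ax"
  shows "J_list k m (list_encode (map code_tm ts))
    (list_encode (map (\<lambda>t. code_tm (tsubst (subst_code k m) t)) ts)) \<in> theorem_codes ax"
  using assms
proof (induction ts)
  case Nil
  then show ?case
    using theorem_codes_step[of 7 ax "[k, m, 0, 0, 0, 0]"] by (simp add: theorem_codes_simps)
next
  case (Cons t ts)
  then show ?case
    using theorem_codes_step[of 8 ax "[k, m, code_tm t, code_tm (tsubst (subst_code k m) t),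
      list_encode (map code_tm ts), list_encode (map (\<lambda>t. code_tm (tsubst (subst_code k m) t)) ts)]"]
    by (simp add: theorem_codes_simps)
qed

text \<open>The values at variables are left as an assumption because deriving them in turn needs
  this lemma, for the plain shift.\<close>

lemma J_tm_complete:
  assumes "\<And>i. J_var k m i (code_tm (subst_code k m i)) \<in> theorem_codes ax"
  shows "J_tm k m (code_tm t) (code_tm (tsubst (subst_code k m) t)) \<in> theorem_codes ax"
proof (induction t)
  case (Var i)
  show ?case
    using assms[of i] theorem_codes_step[of 5 ax "[k, m, i, code_tm (subst_code k m i), 0, 0]"]
    by (simp add: theorem_codes_simps)
next
  case (Fun f ts)
  then show ?case
    using J_list_complete[of ts k m ax] theorem_codes_step[of 6 ax "[k, m, list_encode (map code_tm ts),
        list_encode (map (\<lambda>t. code_tm (tsubst (subst_code k m) t)) ts), f, 0]"]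
    by (simp add: theorem_codes_simps comp_def)
qed

text \<open>Below a further quantifier the value at a variable is the lift of an earlier value, and
  that lift is itself a derived term judgement.\<close>

lemma J_var_complete:
  assumes "m = 0 \<or> m = Suc (code_tm t)"
  shows "J_var k m i (code_tm (subst_code k m i)) \<in> theorem_codes ax"
proof (induction k arbitrary: i)
  case 0
  consider "m = 0" | "m = Suc (code_tm t)" "i = 0" | j where "m = Suc (code_tm t)" "i = Suc j"
    using assms by (cases i) auto
  then show ?case
  proof cases
    case 1
    then show ?thesis
      using theorem_codes_step[of 0 ax "[i, 0, 0, 0, 0, 0]"] by (simp add: theorem_codes_simps)
  next
    case 2
    then show ?thesis
      using theorem_codes_step[of 1 ax "[code_tm t, 0, 0, 0, 0, 0]"] by (simp add: theorem_codes_simps)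
  next
    case 3
    then show ?thesis
      using theorem_codes_step[of 2 ax "[code_tm t, j, 0, 0, 0, 0]"] by (simp add: theorem_codes_simps)
  qed
next
  case (Suc k)
  show ?case
  proof (cases i)
    case 0
    then show ?thesis
      using theorem_codes_step[of 3 ax "[k, m, 0, 0, 0, 0]"] by (simp add: theorem_codes_simps)
  next
    case (Suc j)
    let ?s = "subst_code k m j"
    \<comment> \<open>No circularity arises: for the shift, \<open>k = m = 0\<close>, the values at
      variables come from a rule with trivial premises.\<close>
    have "J_var 0 0 l (code_tm (subst_code 0 0 l)) \<in> theorem_codes ax" for l
      using theorem_codes_step[of 0 ax "[l, 0, 0, 0, 0, 0]"] by (simp add: theorem_codes_simps)
    from J_tm_complete[OF this, of ?s] show ?thesis
      using Suc \<open>\<And>i. J_var k m i (code_tm (subst_code k m i)) \<in> theorem_codes ax\<close>[of j]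
        theorem_codes_step[of 4 ax "[k, m, j, code_tm ?s, code_tm (tlift ?s), 0]"]
      by (simp add: theorem_codes_simps)
  qed
qed

text \<open>The induction keeps \<open>k\<close> arbitrary because passing under a quantifier raises
  it by one.\<close>

lemma J_fm_complete:
  assumes m: "m = 0 \<or> m = Suc (code_tm t)"
  shows "J_fm k m (code \<phi>) (code (subst (subst_code k m) \<phi>)) \<in> theorem_codes ax"
proof (induction \<phi> arbitrary: k)
  case Bot
  show ?case
    using theorem_codes_step[of 9 ax "[k, m, 0, 0, 0, 0]"] by (simp add: theorem_codes_simps)
next
  case (Eq u v)
  show ?case
    using theorem_codes_step[of 10 ax "[k, m, code_tm u, code_tm (tsubst (subst_code k m) u),
        code_tm v, code_tm (tsubst (subst_code k m) v)]"]
      J_tm_complete[of k m ax, OF J_var_complete[OF m]]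
    by (simp add: theorem_codes_simps)
next
  case (Rel r ts)
  show ?case
    using theorem_codes_step[of 11 ax "[k, m, list_encode (map code_tm ts),
        list_encode (map (\<lambda>t. code_tm (tsubst (subst_code k m) t)) ts), r, 0]"]
      J_list_complete[of ts k m ax, OF J_tm_complete[OF J_var_complete[OF m]]]
    by (simp add: theorem_codes_simps comp_def)
next
  case (Imp \<phi> \<psi>)
  then show ?case
    using theorem_codes_step[of 12 ax "[k, m, code \<phi>, code (subst (subst_code k m) \<phi>),
        code \<psi>, code (subst (subst_code k m) \<psi>)]"]
    by (simp add: theorem_codes_simps)
next
  case (All \<phi>)
  then show ?case
    using theorem_codes_step[of 13 ax "[k, m, code \<phi>, code (subst (subst_code (Suc k) m) \<phi>), 0, 0]"]
      All[of "Suc k"]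
    by (simp add: theorem_codes_simps)
qed

text \<open>The rules at positions 14 to 24 match the clauses of \<open>proves\<close> in order.
  Where a clause involves a substitution, \<open>J_fm_complete\<close> supplies the
  premises.\<close>

lemma J_thm_complete:
  assumes ax: "\<And>\<phi>. \<phi> \<in> T \<Longrightarrow> \<exists>k. ax [k, code \<phi>] = 0"
  shows "T \<turnstile> \<phi> \<Longrightarrow> J_thm (code \<phi>) \<in> theorem_codes ax"
proof (induction rule: proves.induct)
  case (Axiom \<phi>)
  then obtain k where "ax [k, code \<phi>] = 0" using ax by blast
  then show ?case
    using theorem_codes_step[of 14 ax "[k, code \<phi>, 0, 0, 0, 0]"] by (simp add: theorem_codes_simps)
next
  case (MP \<phi> \<psi>)
  then show ?case
    using theorem_codes_step[of 15 ax "[code \<phi>, code \<psi>, 0, 0, 0, 0]"] by (simp add: theorem_codes_simps)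
next
  case (Gen \<phi>)
  then show ?case
    using theorem_codes_step[of 16 ax "[code \<phi>, 0, 0, 0, 0, 0]"] by (simp add: theorem_codes_simps)
next
  case (K \<phi> \<psi>)
  show ?case
    using theorem_codes_step[of 17 ax "[code \<phi>, code \<psi>, 0, 0, 0, 0]"] by (simp add: theorem_codes_simps)
next
  case (S \<phi> \<psi> \<chi>)
  show ?case
    using theorem_codes_step[of 18 ax "[code \<phi>, code \<psi>, code \<chi>, 0, 0, 0]"]
    by (simp add: theorem_codes_simps)
next
  case (DN \<phi>)
  show ?case
    using theorem_codes_step[of 19 ax "[code \<phi>, 0, 0, 0, 0, 0]"] by (simp add: theorem_codes_simps)
next
  case (All_imp \<phi> \<psi>)
  show ?case
    using theorem_codes_step[of 20 ax "[code \<phi>, code \<psi>, 0, 0, 0, 0]"] by (simp add: theorem_codes_simps)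
next
  case (All_vacuous \<phi>)
  show ?case
    using theorem_codes_step[of 21 ax "[code \<phi>, code (lift \<phi>), 0, 0, 0, 0]"]
      J_fm_complete[of 0 _ 0 \<phi> ax]
    by (simp add: theorem_codes_simps)
next
  case (All_inst \<phi> t)
  show ?case
    using theorem_codes_step[of 22 ax "[code \<phi>, code (inst t \<phi>), code_tm t, 0, 0, 0]"]
      J_fm_complete[of "Suc (code_tm t)" t 0 \<phi> ax]
    by (simp add: theorem_codes_simps inst_def)
next
  case (Eq_refl t)
  show ?case
    using theorem_codes_step[of 23 ax "[code_tm t, 0, 0, 0, 0, 0]"] by (simp add: theorem_codes_simps)
next
  case (Eq_Leibniz s t \<phi>)
  show ?case
    using theorem_codes_step[of 24 ax
        "[code_tm s, code_tm t, code \<phi>, code (inst s \<phi>), code (inst t \<phi>), 0]"]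
      J_fm_complete[of "Suc (code_tm s)" s 0 \<phi> ax] J_fm_complete[of "Suc (code_tm t)" t 0 \<phi> ax]
    by (simp add: theorem_codes_simps inst_def)
qed

section \<open>Enumerating the theorems\<close>

lemma recursive_judgement:
  assumes "recursive n k" "recursive n m" "recursive n a" "recursive n b"
  shows "recursive n (\<lambda>xs. judgement j (k xs) (m xs) (a xs) (b xs))"
  unfolding judgement_def by (intro recursive_intros assms)

lemma recursive_proof_rules:
  assumes "recursive 2 ax" "(p, q, c) \<in> set (proof_rules ax)"
  shows "recursive 6 p \<and> recursive 6 q \<and> recursive 6 c"
proof -
  have "list_all (\<lambda>(p, q, c). recursive 6 p \<and> recursive 6 q \<and> recursive 6 c) (proof_rules ax)"
    unfolding proof_rules_def list.pred_inject prod.case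
    by (intro conjI recursive_const recursive_judgement recursive_prod_encode recursive_Suc
        recursive_if_0 recursive_2[OF assms(1)] recursive_proj) simp_all
  then show ?thesis using assms(2) by (auto simp: list_all_iff)
qed

lemma re_1E:
  assumes "re 1 {[x] | x. x \<in> A}"
  obtains f where "recursive 2 f" "\<And>x. x \<in> A \<longleftrightarrow> (\<exists>k. f [k, x] = 0)"
proof -
  obtain f where f: "recursive (Suc 1) f"
    "\<forall>xs. length xs = 1 \<longrightarrow> (xs \<in> {[x] | x. x \<in> A} \<longleftrightarrow> (\<exists>k. f (k # xs) = 0))"
    using assms unfolding re_def by blast
  have "x \<in> A \<longleftrightarrow> (\<exists>k. f [k, x] = 0)" for x using f(2)[rule_format, of "[x]"] by simp
  then show thesis using that f(1) by (simp add: numeral_2_eq_2)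
qed

text \<open>Soundness and completeness of \<open>proof_rules\<close> identify provability with
  membership in a Horn set, which is RE. An enumeration of the axioms provides
  \<open>ax\<close>.\<close>

lemma re_theorems:
  assumes "re_theory L T"
  obtains f where "recursive 2 f" "\<And>\<phi>. T \<turnstile> \<phi> \<longleftrightarrow> (\<exists>k. f [k, code \<phi>] = 0)"
proof -
  have "{[code \<phi>] | \<phi>. \<phi> \<in> T} = {[x] | x. x \<in> code ` T}" by blast
  then have "re 1 {[x] | x. x \<in> code ` T}" using assms unfolding re_theory_def by simp
  from re_1E[OF this] obtain ax where ax: "recursive 2 ax"
    "\<And>c. c \<in> code ` T \<longleftrightarrow> (\<exists>k. ax [k, c] = 0)" by blast
  have iff: "T \<turnstile> \<phi> \<longleftrightarrow> J_thm (code \<phi>) \<in> horn 6 (proof_rules ax)" for \<phi>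
  proof
    assume "T \<turnstile> \<phi>"
    moreover have "\<exists>k. ax [k, code \<phi>] = 0" if "\<phi> \<in> T" for \<phi>
      using that ax(2)[of "code \<phi>"] by blast
    ultimately show "J_thm (code \<phi>) \<in> horn 6 (proof_rules ax)"
      using J_thm_complete unfolding theorem_codes_def by blast
  next
    assume "J_thm (code \<phi>) \<in> horn 6 (proof_rules ax)"
    then have "holds T (J_thm (code \<phi>))"
      by (rule proof_rules_sound[rotated]) (use ax(2) in auto)
    then show "T \<turnstile> \<phi>" by simp
  qed
  obtain g where g: "recursive 2 g" "\<And>c. c \<in> horn 6 (proof_rules ax) \<longleftrightarrow> (\<exists>k. g [k, c] = 0)"
    using re_1E[OF re_horn[OF recursive_proof_rules[OF ax(1)]]] by blast
  have "recursive 2 (\<lambda>xs. g [xs ! 0, J_thm (xs ! 1)])"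
    by (intro recursive_2[OF g(1)] recursive_proj recursive_judgement recursive_const) simp_all
  then show thesis using that iff g(2) by simp
qed

section \<open>Provable equivalence\<close>

text \<open>Generalization is confined to theorems of \<open>T\<close>, so hypotheses may have free
  variables and the deduction theorem still holds.\<close>

inductive derives :: "fm set \<Rightarrow> fm set \<Rightarrow> fm \<Rightarrow> bool" for T \<Gamma> where
  d_thm: "T \<turnstile> \<phi> \<Longrightarrow> derives T \<Gamma> \<phi>"
| d_hyp: "\<phi> \<in> \<Gamma> \<Longrightarrow> derives T \<Gamma> \<phi>"
| d_mp: "derives T \<Gamma> (Imp \<phi> \<psi>) \<Longrightarrow> derives T \<Gamma> \<phi> \<Longrightarrow> derives T \<Gamma> \<psi>"

lemma imp_refl: "T \<turnstile> Imp \<phi> \<phi>"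
  using MP[OF MP[OF S K] K] .

lemma imp_trans: "T \<turnstile> Imp \<phi> \<psi> \<Longrightarrow> T \<turnstile> Imp \<psi> \<chi> \<Longrightarrow> T \<turnstile> Imp \<phi> \<chi>"
  using MP[OF MP[OF S MP[OF K]]] .

text \<open>The deduction theorem: \<open>K\<close> covers theorems and the other hypotheses,
  \<open>S\<close> covers modus ponens.\<close>

lemma d_impI: "derives T (insert \<psi> \<Gamma>) \<phi> \<Longrightarrow> derives T \<Gamma> (Imp \<psi> \<phi>)"
proof (induction rule: derives.induct)
  case (d_thm \<phi>)
  then show ?case by (blast intro: derives.d_thm MP K)
next
  case (d_hyp \<phi>)
  then show ?case by (blast intro: derives.intros imp_refl K)
next
  case (d_mp \<phi> \<chi>)
  then show ?case by (blast intro: derives.intros S)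
qed

lemma derives_empty: "derives T {} \<phi> \<Longrightarrow> T \<turnstile> \<phi>"
  by (induction rule: derives.induct) (auto intro: MP)

lemma derives_imp: "derives T {\<psi>} \<phi> \<Longrightarrow> T \<turnstile> Imp \<psi> \<phi>"
  by (simp add: d_impI derives_empty)

lemma derives_mono: "derives T \<Gamma> \<phi> \<Longrightarrow> \<Gamma> \<subseteq> \<Delta> \<Longrightarrow> derives T \<Delta> \<phi>"
  by (induction rule: derives.induct) (auto intro: derives.intros)

lemma d_raa: "derives T (insert (Neg \<phi>) \<Gamma>) Bot \<Longrightarrow> derives T \<Gamma> \<phi>"
  using d_mp[OF d_thm[OF DN] d_impI] .

lemma d_andI:
  assumes "derives T \<Gamma> \<phi>" "derives T \<Gamma> \<psi>" shows "derives T \<Gamma> (And \<phi> \<psi>)"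
proof (rule d_impI)
  let ?\<Delta> = "insert (Imp \<phi> (Neg \<psi>)) \<Gamma>"
  have "derives T ?\<Delta> \<phi>" "derives T ?\<Delta> \<psi>" "derives T ?\<Delta> (Imp \<phi> (Neg \<psi>))"
    using assms by (auto intro: derives_mono d_hyp)
  then show "derives T ?\<Delta> Bot" by (blast intro: d_mp)
qed

lemma d_andE1: assumes "derives T \<Gamma> (And \<phi> \<psi>)" shows "derives T \<Gamma> \<phi>"
proof (rule d_raa, rule d_mp)
  show "derives T (insert (Neg \<phi>) \<Gamma>) (And \<phi> \<psi>)" using assms by (auto intro: derives_mono)
  have "derives T (insert \<psi> (insert \<phi> (insert (Neg \<phi>) \<Gamma>))) Bot"
    by (rule d_mp[of _ _ \<phi>]) (auto intro: d_hyp)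
  then show "derives T (insert (Neg \<phi>) \<Gamma>) (Imp \<phi> (Neg \<psi>))" by (intro d_impI)
qed

lemma d_andE2: assumes "derives T \<Gamma> (And \<phi> \<psi>)" shows "derives T \<Gamma> \<psi>"
proof (rule d_raa, rule d_mp)
  show "derives T (insert (Neg \<psi>) \<Gamma>) (And \<phi> \<psi>)" using assms by (auto intro: derives_mono)
  show "derives T (insert (Neg \<psi>) \<Gamma>) (Imp \<phi> (Neg \<psi>))" by (rule d_impI) (auto intro: d_hyp)
qed

lemma contrapos: "T \<turnstile> Imp \<phi> \<psi> \<Longrightarrow> T \<turnstile> Imp (Neg \<psi>) (Neg \<phi>)"
  by (rule derives_imp, rule d_impI, rule d_mp[of _ _ \<psi>]; blast intro: derives.intros)

lemma all_mono: "T \<turnstile> Imp \<phi> \<psi> \<Longrightarrow> T \<turnstile> Imp (All \<phi>) (All \<psi>)"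
  using MP[OF All_imp Gen] .

lemma ex_mono: "T \<turnstile> Imp \<phi> \<psi> \<Longrightarrow> T \<turnstile> Imp (Ex \<phi>) (Ex \<psi>)"
  by (intro contrapos all_mono)

lemma and_mono:
  assumes "T \<turnstile> Imp \<phi> \<phi>'" "T \<turnstile> Imp \<psi> \<psi>'" shows "T \<turnstile> Imp (And \<phi> \<psi>) (And \<phi>' \<psi>')"
proof (rule derives_imp)
  have "derives T {And \<phi> \<psi>} \<phi>" "derives T {And \<phi> \<psi>} \<psi>"
    by (blast intro: d_andE1 d_andE2 d_hyp)+
  then show "derives T {And \<phi> \<psi>} (And \<phi>' \<psi>')"
    using assms by (blast intro: d_andI d_mp d_thm)
qed

lemma and_left_commute: "T \<turnstile> Imp (And \<phi> (And \<psi> \<chi>)) (And \<psi> (And \<phi> \<chi>))"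
proof (rule derives_imp)
  let ?\<Gamma> = "{And \<phi> (And \<psi> \<chi>)}"
  have "derives T ?\<Gamma> \<phi>" "derives T ?\<Gamma> (And \<psi> \<chi>)" by (blast intro: d_andE1 d_andE2 d_hyp)+
  then show "derives T ?\<Gamma> (And \<psi> (And \<phi> \<chi>))" by (blast intro: d_andI d_andE1 d_andE2)
qed

lemma and_ex_prenex: "T \<turnstile> Imp (And \<phi> (Ex \<psi>)) (Ex (And (lift \<phi>) \<psi>))"
proof (rule derives_imp, rule d_impI)
  let ?\<Gamma> = "{All (Neg (And (lift \<phi>) \<psi>)), And \<phi> (Ex \<psi>)}"
  \<comment> \<open>Both hypotheses get discharged, leaving a theorem to which \<open>Gen\<close>
    applies; \<open>All_imp\<close> then distributes the quantifier.\<close>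
  have "derives T {Neg (And (lift \<phi>) \<psi>), lift \<phi>} (Neg \<psi>)"
    by (rule d_impI, rule d_mp[of _ _ "And (lift \<phi>) \<psi>"]) (auto intro: d_hyp d_andI)
  then have "T \<turnstile> Imp (lift \<phi>) (Imp (Neg (And (lift \<phi>) \<psi>)) (Neg \<psi>))"
    by (rule derives_imp[OF d_impI])
  from MP[OF All_imp Gen[OF this]]
  have "derives T ?\<Gamma> (Imp (All (lift \<phi>)) (All (Imp (Neg (And (lift \<phi>) \<psi>)) (Neg \<psi>))))"
    by (rule d_thm)
  moreover have "derives T ?\<Gamma> \<phi>" by (rule d_andE1[of _ _ _ "Ex \<psi>"]) (simp add: d_hyp)
  then have "derives T ?\<Gamma> (All (lift \<phi>))" by (rule d_mp[OF d_thm[OF All_vacuous]])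
  ultimately have "derives T ?\<Gamma> (All (Imp (Neg (And (lift \<phi>) \<psi>)) (Neg \<psi>)))" by (rule d_mp)
  then have "derives T ?\<Gamma> (Imp (All (Neg (And (lift \<phi>) \<psi>))) (All (Neg \<psi>)))"
    by (rule d_mp[OF d_thm[OF All_imp]])
  then have "derives T ?\<Gamma> (All (Neg \<psi>))" by (rule d_mp) (simp add: d_hyp)
  moreover have "derives T ?\<Gamma> (Ex \<psi>)" by (rule d_andE2[of _ _ \<phi>]) (simp add: d_hyp)
  ultimately show "derives T ?\<Gamma> Bot" by (blast intro: d_mp)
qed

text \<open>The contrapositive of \<open>All_vacuous\<close> for the negated formula.\<close>

lemma ex_lift: "T \<turnstile> Imp (Ex (lift \<phi>)) \<phi>"
proof -
  have "T \<turnstile> Imp (Neg \<phi>) (All (Neg (lift \<phi>)))" using All_vacuous[of T "Neg \<phi>"] by simp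
  then have "T \<turnstile> Imp (Ex (lift \<phi>)) (Neg (Neg \<phi>))" by (rule contrapos)
  then show ?thesis using DN by (rule imp_trans)
qed

lemma ex_and_prenex: "T \<turnstile> Imp (Ex (And (lift \<phi>) \<psi>)) (And \<phi> (Ex \<psi>))"
proof -
  have "T \<turnstile> Imp (And (lift \<phi>) \<psi>) (lift \<phi>)" "T \<turnstile> Imp (And (lift \<phi>) \<psi>) \<psi>"
    by (auto intro: derives_imp d_andE1 d_andE2 d_hyp)
  then have "T \<turnstile> Imp (Ex (And (lift \<phi>) \<psi>)) \<phi>" "T \<turnstile> Imp (Ex (And (lift \<phi>) \<psi>)) (Ex \<psi>)"
    using imp_trans[OF ex_mono ex_lift] ex_mono by blast+
  then show ?thesis by (blast intro: derives_imp d_andI d_mp d_thm d_hyp)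
qed

section \<open>Provable equivalence as a congruence\<close>

definition prov_equiv :: "fm set \<Rightarrow> fm \<Rightarrow> fm \<Rightarrow> bool" where
  "prov_equiv T \<phi> \<psi> \<longleftrightarrow> T \<turnstile> Imp \<phi> \<psi> \<and> T \<turnstile> Imp \<psi> \<phi>"

lemma prov_equiv_refl: "prov_equiv T \<phi> \<phi>"
  by (simp add: prov_equiv_def imp_refl)

lemma prov_equiv_trans [trans]:
  "prov_equiv T \<phi> \<psi> \<Longrightarrow> prov_equiv T \<psi> \<chi> \<Longrightarrow> prov_equiv T \<phi> \<chi>"
  unfolding prov_equiv_def by (blast intro: imp_trans)

lemma prov_equiv_provable: "prov_equiv T \<phi> \<psi> \<Longrightarrow> T \<turnstile> \<phi> \<longleftrightarrow> T \<turnstile> \<psi>"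
  unfolding prov_equiv_def by (blast intro: MP)

lemma prov_equiv_refutable: "prov_equiv T \<phi> \<psi> \<Longrightarrow> T \<turnstile> Neg \<phi> \<longleftrightarrow> T \<turnstile> Neg \<psi>"
  unfolding prov_equiv_def by (blast intro: MP contrapos)

lemma prov_equiv_and: "prov_equiv T \<phi> \<psi> \<Longrightarrow> prov_equiv T (And \<chi> \<phi>) (And \<chi> \<psi>)"
  unfolding prov_equiv_def by (blast intro: and_mono imp_refl)

lemma prov_equiv_ex: "prov_equiv T \<phi> \<psi> \<Longrightarrow> prov_equiv T (Ex \<phi>) (Ex \<psi>)"
  unfolding prov_equiv_def by (blast intro: ex_mono)

lemma prov_equiv_exs: "prov_equiv T \<phi> \<psi> \<Longrightarrow> prov_equiv T ((Ex ^^ n) \<phi>) ((Ex ^^ n) \<psi>)"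
  by (induction n) (simp_all add: prov_equiv_ex)

lemma foldr_and_left_commute:
  "prov_equiv T (foldr And \<chi>s (And \<phi> \<psi>)) (And \<phi> (foldr And \<chi>s \<psi>))"
proof (induction \<chi>s)
  case (Cons \<chi> \<chi>s)
  have "prov_equiv T (And \<chi> (And \<phi> (foldr And \<chi>s \<psi>))) (And \<phi> (And \<chi> (foldr And \<chi>s \<psi>)))"
    by (simp add: prov_equiv_def and_left_commute)
  then show ?case using prov_equiv_trans[OF prov_equiv_and[OF Cons, of \<chi>]] by simp
qed (simp add: prov_equiv_refl)

lemma foldr_and_ex:
  "prov_equiv T (foldr And \<chi>s (Ex \<phi>)) (Ex (foldr And (map lift \<chi>s) \<phi>))"
proof (induction \<chi>s)
  case (Cons \<chi> \<chi>s)
  have "prov_equiv T (And \<chi> (Ex (foldr And (map lift \<chi>s) \<phi>)))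
    (Ex (And (lift \<chi>) (foldr And (map lift \<chi>s) \<phi>)))"
    by (simp add: prov_equiv_def and_ex_prenex ex_and_prenex)
  then show ?case using prov_equiv_trans[OF prov_equiv_and[OF Cons, of \<chi>]] by simp
qed (simp add: prov_equiv_refl)

subsection \<open>Substitution and numerals\<close>

lemma tsubst_id: "(\<And>i. i \<in> tfv t \<Longrightarrow> \<sigma> i = Var i) \<Longrightarrow> tsubst \<sigma> t = t"
  by (induction t) (auto intro!: map_idI)

lemma tsubst_cong: "(\<And>i. i \<in> tfv t \<Longrightarrow> \<sigma> i = \<tau> i) \<Longrightarrow> tsubst \<sigma> t = tsubst \<tau> t"
  by (induction t) auto

lemma subst_cong: "(\<And>i. i \<in> fv \<phi> \<Longrightarrow> \<sigma> i = \<tau> i) \<Longrightarrow> subst \<sigma> \<phi> = subst \<tau> \<phi>"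
proof (induction \<phi> arbitrary: \<sigma> \<tau>)
  case (Eq s t)
  then show ?case by (auto intro!: tsubst_cong)
next
  case (Rel r ts)
  then show ?case by (auto intro!: tsubst_cong)
next
  case (Imp \<phi> \<psi>)
  show ?case using Imp.IH[of \<sigma> \<tau>] Imp.prems by simp
next
  case (All \<phi>)
  show ?case using All.prems by (auto intro!: All.IH split: nat.split)
qed simp

lemma tsubst_tsubst: "tsubst \<sigma> (tsubst \<tau> t) = tsubst (\<lambda>i. tsubst \<sigma> (\<tau> i)) t"
  by (induction t) auto

lemma subst_subst: "subst \<sigma> (subst \<tau> \<phi>) = subst (\<lambda>i. tsubst \<sigma> (\<tau> i)) \<phi>"
proof (induction \<phi> arbitrary: \<sigma> \<tau>)
  case (All \<phi>)
  show ?case by (simp add: All) (auto intro!: subst_cong simp: tsubst_tsubst split: nat.split)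
qed (auto simp: tsubst_tsubst)

lemma subst_Var: "subst Var \<phi> = \<phi>"
proof (induction \<phi>)
  case (All \<phi>)
  have "case_nat (Var 0) (\<lambda>i. Var (Suc i)) = Var" by (auto split: nat.split)
  then show ?case using All by simp
qed (auto intro!: tsubst_id map_idI)

lemma tfv_tsubst: "tfv (tsubst \<sigma> t) = (\<Union>i\<in>tfv t. tfv (\<sigma> i))"
  by (induction t) auto

lemma fv_subst: "fv (subst \<sigma> \<phi>) = (\<Union>i\<in>fv \<phi>. tfv (\<sigma> i))"
proof (induction \<phi> arbitrary: \<sigma>)
  case (All \<phi>)
  have "Suc i \<in> tfv (case j of 0 \<Rightarrow> Var 0 | Suc k \<Rightarrow> tlift (\<sigma> k)) \<longleftrightarrow> (\<exists>k. j = Suc k \<and> i \<in> tfv (\<sigma> k))"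
    for i j by (cases j) (auto simp: tfv_tsubst)
  then show ?case by (auto simp: All)
qed (auto simp: tfv_tsubst)

lemma wf_tm_tsubst: "wf_tm L t \<Longrightarrow> (\<And>i. wf_tm L (\<sigma> i)) \<Longrightarrow> wf_tm L (tsubst \<sigma> t)"
  by (induction t) auto

lemma wf_fm_subst: "wf_fm L \<phi> \<Longrightarrow> (\<And>i. wf_tm L (\<sigma> i)) \<Longrightarrow> wf_fm L (subst \<sigma> \<phi>)"
proof (induction \<phi> arbitrary: \<sigma>)
  case (All \<phi>)
  have "wf_tm L (case i of 0 \<Rightarrow> Var 0 | Suc k \<Rightarrow> tlift (\<sigma> k))" for i
    using All.prems(2) by (auto intro!: wf_tm_tsubst split: nat.split)
  then show ?case using All by simp
qed (auto intro!: wf_tm_tsubst)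

lemma fv_app: "fv \<phi> \<subseteq> {..<length ts} \<Longrightarrow> fv (app \<phi> ts) \<subseteq> (\<Union>t\<in>set ts. tfv t)"
  by (force simp: app_def fv_subst)

lemma wf_app: "wf_fm L \<phi> \<Longrightarrow> \<forall>t\<in>set ts. wf_tm L t \<Longrightarrow> wf_fm L (app \<phi> ts)"
  by (auto simp: app_def intro!: wf_fm_subst)

lemma subst_app:
  "fv \<phi> \<subseteq> {..<length ts} \<Longrightarrow> subst \<sigma> (app \<phi> ts) = app \<phi> (map (tsubst \<sigma>) ts)"
  by (auto simp: app_def subst_subst intro!: subst_cong)

lemma tsubst_numeral_tm [simp]: "tsubst \<sigma> (numeral_tm a) = numeral_tm a"
  by (induction a) auto

text \<open>A numeral is never a variable, so the clause of \<open>graph\<close> for compound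
  arguments applies, and lifting leaves the closed argument unchanged.\<close>

lemma graph_numeral_Suc:
  "graph I (numeral_tm (Suc a)) y = Ex (And (tr_dom I) (And (graph I (numeral_tm a) 0)
     (app (tr_succ I) [Var 0, Var (Suc y)])))"
  by (cases a) auto

context
  fixes L I
  assumes I: "translation_into L I"
begin

lemma fv_graph_numeral: "fv (graph I (numeral_tm a) y) \<subseteq> {y}"
proof (induction a arbitrary: y)
  case 0
  show ?case using I fv_app[of "tr_zero I" "[Var y]"] by (auto simp: translation_into_def)
next
  case (Suc a)
  have "fv (app (tr_succ I) [Var 0, Var (Suc y)]) \<subseteq> {0, Suc y}"
    using I fv_app[of "tr_succ I" "[Var 0, Var (Suc y)]"] by (auto simp: translation_into_def)
  then show ?case
    using I Suc[of 0] unfolding graph_numeral_Suc translation_into_def by auto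
qed

lemma wf_graph_numeral: "wf_fm L (graph I (numeral_tm a) y)"
proof (induction a arbitrary: y)
  case 0
  show ?case using I by (auto simp: translation_into_def intro!: wf_app)
next
  case (Suc a)
  then show ?case
    using I unfolding graph_numeral_Suc translation_into_def by (auto intro!: wf_app)
qed

text \<open>The value of the predecessor is the bound variable 0, which the shift leaves alone; only
  the outer index \<open>y\<close> moves.\<close>

lemma lift_graph_numeral: "lift (graph I (numeral_tm a) y) = graph I (numeral_tm a) (Suc y)"
proof (cases a)
  case 0
  have "fv (tr_zero I) \<subseteq> {..<length [Var y]}" using I by (auto simp: translation_into_def)
  then show ?thesis by (simp add: 0 subst_app)
next
  case (Suc b)
  let ?\<sigma> = "case_nat (Var 0) (\<lambda>i. tlift (Var (Suc i)))"
  have id: "subst ?\<sigma> \<phi> = \<phi>" if "fv \<phi> \<subseteq> {0}" for \<phi>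
  proof -
    have "subst ?\<sigma> \<phi> = subst Var \<phi>"
      by (intro subst_cong) (use that in \<open>auto split: nat.split\<close>)
    then show ?thesis by (simp add: subst_Var)
  qed
  have "fv (tr_succ I) \<subseteq> {..<length [Var 0, Var (Suc y)]}" using I by (auto simp: translation_into_def)
  then have "subst ?\<sigma> (app (tr_succ I) [Var 0, Var (Suc y)]) = app (tr_succ I) [Var 0, Var (Suc (Suc y))]"
    by (simp add: subst_app)
  moreover have "subst ?\<sigma> (tr_dom I) = tr_dom I" using I by (intro id) (simp add: translation_into_def)
  moreover have "subst ?\<sigma> (graph I (numeral_tm b) 0) = graph I (numeral_tm b) 0"
    by (intro id fv_graph_numeral)
  ultimately show ?thesis unfolding Suc graph_numeral_Suc by simp
qed

end

section \<open>Instantiating a variable by a numeral\<close>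

definition is_numeral :: "translation \<Rightarrow> nat \<Rightarrow> nat \<Rightarrow> fm" where
  "is_numeral I a i = And (app (tr_dom I) [Var i]) (graph I (numeral_tm a) i)"

text \<open>Under a translation a numeral is given only by a formula describing its value, so
  instantiation is a quantification. It binds variable 0 and thereby lowers the other indices by
  one.\<close>

definition inst_num :: "translation \<Rightarrow> nat \<Rightarrow> fm \<Rightarrow> fm" where
  "inst_num I a \<phi> = Ex (And (is_numeral I a 0) \<phi>)"

lemma lift_is_numeral:
  "translation_into L I \<Longrightarrow> lift (is_numeral I a i) = is_numeral I a (Suc i)"
  using subst_app[of "tr_dom I" "[Var i]"]
  by (auto simp: is_numeral_def lift_graph_numeral translation_into_def)

text \<open>The two formulas differ in the place of the quantifier for \<open>a\<close>: it is
  pulled out of the conjunction of the other numeral clauses, which are lifted, and its own clause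
  is moved to the front.\<close>

lemma at_numerals_inst_num:
  assumes "translation_into L I"
  shows "prov_equiv T (at_numerals I (inst_num I a \<phi>) as) (at_numerals I \<phi> (a # as))"
proof -
  let ?\<chi>s = "map (\<lambda>i. is_numeral I (as ! i) i) [0..<length as]"
  have "map (\<lambda>i. is_numeral I ((a # as) ! i) i) [0..<length (a # as)] =
      is_numeral I a 0 # map lift ?\<chi>s"
    by (rule nth_equalityI) (auto simp: nth_Cons' lift_is_numeral[OF assms] simp del: upt_Suc)
  then have eq: "at_numerals I \<phi> (a # as) =
      (Ex ^^ length as) (Ex (And (is_numeral I a 0) (foldr And (map lift ?\<chi>s) \<phi>)))"
    unfolding at_numerals_def is_numeral_def[symmetric] by (simp del: upt_Suc funpow.simps add: funpow_Suc_right)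
  have "prov_equiv T (foldr And ?\<chi>s (inst_num I a \<phi>))
      (Ex (foldr And (map lift ?\<chi>s) (And (is_numeral I a 0) \<phi>)))"
    unfolding inst_num_def by (rule foldr_and_ex)
  also have "prov_equiv T \<dots> (Ex (And (is_numeral I a 0) (foldr And (map lift ?\<chi>s) \<phi>)))"
    by (intro prov_equiv_ex foldr_and_left_commute)
  finally show ?thesis
    unfolding eq unfolding at_numerals_def is_numeral_def[symmetric] by (rule prov_equiv_exs)
qed

lemma formula_in_inst_num:
  assumes "translation_into L I" "formula_in L (Suc n) \<phi>"
  shows "formula_in L n (inst_num I a \<phi>)"
proof -
  have "fv (is_numeral I a 0) \<subseteq> {0}"
    using assms(1) fv_graph_numeral[OF assms(1), of a 0] fv_app[of "tr_dom I" "[Var 0]"]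
    by (auto simp: is_numeral_def translation_into_def)
  then have "fv (inst_num I a \<phi>) = {..<n}"
    using assms(2) by (auto simp: inst_num_def formula_in_def)
  moreover have "wf_fm L (inst_num I a \<phi>)"
    using assms wf_graph_numeral[OF assms(1), of a 0]
    by (auto simp: inst_num_def is_numeral_def formula_in_def translation_into_def intro!: wf_app)
  ultimately show ?thesis by (simp add: formula_in_def)
qed

subsection \<open>Recursiveness of numeral instances\<close>

lemma recursive_code_Imp:
  "recursive n (\<lambda>xs. code (F xs)) \<Longrightarrow> recursive n (\<lambda>xs. code (G xs)) \<Longrightarrow>
    recursive n (\<lambda>xs. code (Imp (F xs) (G xs)))"
  by (simp add: recursive_prod_encode recursive_const)

lemma recursive_code_All:
  "recursive n (\<lambda>xs. code (F xs)) \<Longrightarrow> recursive n (\<lambda>xs. code (All (F xs)))"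
  by (simp add: recursive_prod_encode recursive_const)

text \<open>The function \<open>g\<close> computes the code for a successor from the code for its
  predecessor. All predecessors sit at the bound variable 0, so the recursion runs at 0 and only its
  last step uses \<open>y\<close>.\<close>

lemma recursive_code_graph_numeral:
  assumes "recursive n f"
  shows "recursive n (\<lambda>xs. code (graph I (numeral_tm (f xs)) y))"
proof -
  define g where "g r y = c_neg (c_all (c_neg (c_neg (c_imp (code (tr_dom I)) (c_neg (c_neg (c_imp r
        (c_neg (code (app (tr_succ I) [Var 0, Var (Suc y)]))))))))))" for r y
  have step: "code (graph I (numeral_tm (Suc a)) y) = g (code (graph I (numeral_tm a) 0)) y" for a y
    unfolding graph_numeral_Suc g_def by simp
  have rec_g: "recursive m (\<lambda>xs. g (r xs) y)" if "recursive m r" for m r y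
    unfolding g_def by (intro recursive_prod_encode recursive_const that)
  have 0: "code (graph I (numeral_tm a) 0) = rec_nat (code (graph I Zero 0)) (\<lambda>k r. g r 0) a" for a
    by (induction a) (simp, simp only: step nat.rec)
  have "recursive n (\<lambda>xs. if f xs = 0 then code (graph I Zero y)
      else g (rec_nat (code (graph I Zero 0)) (\<lambda>k r. g r 0) (f xs - 1)) y)"
    by (intro recursive_if_0 assms recursive_const rec_g recursive_rec_nat recursive_pred recursive_proj) simp
  moreover have "code (graph I (numeral_tm a) y) = (if a = 0 then code (graph I Zero y)
      else g (rec_nat (code (graph I Zero 0)) (\<lambda>k r. g r 0) (a - 1)) y)" for a
    unfolding 0[symmetric] by (cases a) (simp, simp only: step nat.simps if_False diff_Suc_1)
  ultimately show ?thesis by simp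
qed

lemma recursive_code_is_numeral:
  "recursive n f \<Longrightarrow> recursive n (\<lambda>xs. code (is_numeral I (f xs) i))"
  unfolding is_numeral_def
  by (intro recursive_code_Imp recursive_code_graph_numeral recursive_const)

lemma recursive_code_inst_num:
  "recursive n f \<Longrightarrow> recursive n (\<lambda>xs. code (F xs)) \<Longrightarrow>
    recursive n (\<lambda>xs. code (inst_num I (f xs) (F xs)))"
  unfolding inst_num_def
  by (intro recursive_code_Imp recursive_code_All recursive_code_is_numeral recursive_const)

text \<open>The code of the formula is an argument here, as required for evaluating the formula
  coded by \<open>e\<close> at \<open>e\<close>. It occupies entry 0, whence
  \<open>xs ! Suc i\<close> for the numeral of variable \<open>i\<close>.\<close>

lemma recursive_code_at_numerals:
  obtains F where "recursive (Suc n) F"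
    "\<And>\<phi> as. length as = n \<Longrightarrow> F (code \<phi> # as) = code (at_numerals I \<phi> as)"
proof
  let ?and = "\<lambda>a b. c_neg (c_imp a (c_neg b))"
  let ?ex = "\<lambda>a. c_neg (c_all (c_neg a))"
  define F where "F = (\<lambda>xs. (?ex ^^ n) (foldr (\<lambda>i. ?and (code (is_numeral I (xs ! Suc i) i))) [0..<n] (xs ! 0)))"
  have *: "recursive (Suc n) (\<lambda>xs. foldr (\<lambda>i. ?and (code (is_numeral I (xs ! Suc i) i))) is (xs ! 0))"
    if "set is \<subseteq> {..<n}" for "is"
    using that
    by (induction "is") (auto intro!: recursive_prod_encode recursive_const recursive_proj recursive_code_is_numeral)
  have "recursive m (\<lambda>xs. (?ex ^^ k) (f xs))" if "recursive m f" for m f k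
    by (induction k) (simp_all add: that recursive_prod_encode recursive_const)
  moreover have "set [0..<n] \<subseteq> {..<n}" by auto
  ultimately show "recursive (Suc n) F" unfolding F_def using * by blast
  fix \<phi> and as :: "nat list" assume n: "length as = n"
  have 1: "code ((Ex ^^ k) \<phi>) = (?ex ^^ k) (code \<phi>)" for k \<phi>
    by (induction k) auto
  have 2: "code (foldr And (map (\<lambda>i. is_numeral I (as ! i) i) is) \<phi>) =
    foldr (\<lambda>i. ?and (code (is_numeral I (as ! i) i))) is (code \<phi>)" for "is"
    by (induction "is") auto
  show "F (code \<phi> # as) = code (at_numerals I \<phi> as)"
    unfolding F_def at_numerals_def is_numeral_def[symmetric] by (simp add: 1 2 n)
qed

section \<open>The equivalence of the Rosser properties\<close>

lemma acceptable_enumerationD: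
  assumes "acceptable_enumeration R" "n \<ge> 1"
  shows "range (R n) = {M. re n M}" "re (Suc n) {i # xs | i xs. xs \<in> R n i}"
  using assms unfolding acceptable_enumeration_def by (elim conjE allE[of _ n]; simp)+

lemma re_iff_index:
  assumes "acceptable_enumeration R" "n \<ge> 1"
  shows "re n M \<longleftrightarrow> (\<exists>i. M = R n i)"
proof -
  have "re n M \<longleftrightarrow> M \<in> range (R n)" by (simp add: acceptable_enumerationD[OF assms])
  then show ?thesis by auto
qed

text \<open>In the application \<open>F (e # zs)\<close> is the code of the formula coded by \<open>e\<close> at the numerals of \<open>zs\<close>,
  and \<open>h\<close> is negation or the identity on codes.\<close>

lemma re_index_or_theorem:
  assumes R: "acceptable_enumeration R" and n: "n \<ge> 1" and p: "p < 3"
    and g: "recursive 2 g" and h: "\<And>m f. recursive m f \<Longrightarrow> recursive m (\<lambda>xs. h (f xs))"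
    and F: "recursive (Suc (n + 3)) F"
  shows "re (n + 3) {zs. length zs = n + 3 \<and>
    (drop 3 zs \<in> R n (zs ! p) \<or> (\<exists>k. g [k, h (F (zs ! 0 # zs))] = 0))}"
proof -
  have "re (Suc n) {i # xs | i xs. xs \<in> R n i}"
    by (rule acceptable_enumerationD[OF R n])
  then obtain u where u: "recursive (Suc (Suc n)) u" "\<forall>ys. length ys = Suc n \<longrightarrow>
      (ys \<in> {i # xs | i xs. xs \<in> R n i} \<longleftrightarrow> (\<exists>k. u (k # ys) = 0))"
    unfolding re_def by blast
  have u_iff: "xs \<in> R n i \<longleftrightarrow> (\<exists>k. u (k # i # xs) = 0)" if "length xs = n" for i xs
    using u(2)[rule_format, of "i # xs"] that by simp
  let ?N = "Suc (n + 3)"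
  \<comment> \<open>Entry 0 is the search witness \<open>k\<close>, followed by \<open>zs\<close>;
    thus \<open>zs ! p\<close> is at \<open>Suc p\<close> and \<open>drop 3 zs\<close> starts at
    4.\<close>
  have "recursive ?N (\<lambda>ys. u (map ((!) ys) (0 # Suc p # [4..<?N])))"
    by (rule recursive_select) (use u(1) p in auto)
  then have "recursive ?N (\<lambda>ys. u (ys ! 0 # ys ! Suc p # drop 4 ys))"
    by (rule cong_on) (simp add: map_nth_drop del: upt_Suc)
  moreover have "recursive ?N (\<lambda>ys. F (ys ! 1 # tl ys))"
  proof -
    have "recursive ?N (\<lambda>ys. F (map ((!) ys) (1 # [1..<?N])))"
      by (rule recursive_select) (use F in auto)
    then show ?thesis
      by (rule cong_on) (simp add: map_nth_drop drop_Suc del: upt_Suc)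
  qed
  then have "recursive ?N (\<lambda>ys. g [ys ! 0, h (F (ys ! 1 # tl ys))])"
    by (intro recursive_2[OF g] h recursive_proj) simp_all
  \<comment> \<open>A product vanishes iff a factor does, and an existential quantifier distributes
    over the disjunction.\<close>
  ultimately have rec: "recursive ?N (\<lambda>ys. u (ys ! 0 # ys ! Suc p # drop 4 ys) *
      g [ys ! 0, h (F (ys ! 1 # tl ys))])" (is "recursive _ ?f")
    by (rule recursive_mult)
  have "drop 3 zs \<in> R n (zs ! p) \<or> (\<exists>k. g [k, h (F (zs ! 0 # zs))] = 0) \<longleftrightarrow> (\<exists>k. ?f (k # zs) = 0)"
    if "length zs = n + 3" for zs
    using u_iff[of "drop 3 zs" "zs ! p"] that by auto
  then show ?thesis
    unfolding re_def by (intro conjI exI[of _ ?f] rec) auto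
qed

lemma at_numerals_inst_num_3:
  assumes "translation_into L I"
  shows "prov_equiv T (at_numerals I (inst_num I c (inst_num I b (inst_num I a \<phi>))) as)
    (at_numerals I \<phi> (a # b # c # as))"
  using at_numerals_inst_num[OF assms] prov_equiv_trans by blast

lemma formula_in_inst_num_3:
  assumes "translation_into L I" "formula_in L (n + 3) \<phi>"
  shows "formula_in L n (inst_num I c (inst_num I b (inst_num I a \<phi>)))"
  using assms by (intro formula_in_inst_num) (simp_all add: numeral_3_eq_3)

lemma recursive_code_inst_num_3:
  "recursive 2 (\<lambda>xs. code (inst_num I (xs ! 1) (inst_num I (xs ! 0) (inst_num I a \<phi>))))"
  by (intro recursive_code_inst_num recursive_const recursive_proj) simp_all

lemma effectively_Rosser_if_Rosser:
  assumes R: "acceptable_enumeration R" and T: "Rosser L T"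
  shows "effectively_Rosser R L T"
  unfolding effectively_Rosser_def
proof (intro allI impI)
  fix n :: nat assume n: "n \<ge> 1"
  have "n_Rosser L T (n + 3)" using T by (simp add: Rosser_def)
  then obtain I where I: "Num_interp L T I" and sep: "\<And>M1 M2. re (n + 3) M1 \<Longrightarrow> re (n + 3) M2 \<Longrightarrow>
      \<exists>\<phi>. formula_in L (n + 3) \<phi> \<and> strongly_separates T I (n + 3) \<phi> (M1 - M2) (M2 - M1)"
    unfolding n_Rosser_def by blast
  have tr: "translation_into L I" using I by (simp add: Num_interp_def interprets_Num_def)
  define M where "M p = {zs. length zs = n + 3 \<and> drop 3 zs \<in> R n (zs ! p)}" for p
  have "re (n + 3) (M p)" if "p < 3" for p
    \<comment> \<open>With the constant 1 for \<open>g\<close> the provability clause is never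
      satisfied and only membership in \<open>R n\<close> remains.\<close>
    using re_index_or_theorem[OF R n that, where g="\<lambda>_. 1" and h="\<lambda>x. x" and F="\<lambda>_. 0"]
    by (simp add: M_def recursive_const)
  then have "re (n + 3) (M 1)" "re (n + 3) (M 2)" by simp_all
  then obtain \<phi> where \<phi>: "formula_in L (n + 3) \<phi>"
      "strongly_separates T I (n + 3) \<phi> (M 1 - M 2) (M 2 - M 1)"
    using sep by blast
  \<comment> \<open>Entry 0, the place of the self-code in the exact case, is filled with 0. The
    innermost instance comes first, so the order of the entries is \<open>0\<close>,
    \<open>i\<close>, \<open>j\<close>.\<close>
  define \<psi> where "\<psi> i j = inst_num I j (inst_num I i (inst_num I 0 \<phi>))" for i j
  have "strongly_separates T I n (\<psi> i j) (R n i - R n j) (R n j - R n i)" for i j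
    unfolding strongly_separates_def
  proof (intro allI impI)
    fix as :: "nat list" assume as: "length as = n"
    have "prov_equiv T (at_numerals I (\<psi> i j) as) (at_numerals I \<phi> (0 # i # j # as))"
      unfolding \<psi>_def by (rule at_numerals_inst_num_3[OF tr])
    note this[THEN prov_equiv_provable] this[THEN prov_equiv_refutable]
    moreover have "0 # i # j # as \<in> M 1 \<longleftrightarrow> as \<in> R n i" "0 # i # j # as \<in> M 2 \<longleftrightarrow> as \<in> R n j"
      using as by (simp_all add: M_def)
    ultimately show "(as \<in> R n i - R n j \<longrightarrow> T \<turnstile> at_numerals I (\<psi> i j) as) \<and>
        (as \<in> R n j - R n i \<longrightarrow> T \<turnstile> Neg (at_numerals I (\<psi> i j) as))"
      using \<phi>(2)[unfolded strongly_separates_def, rule_format, of "0 # i # j # as"] as by simp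
  qed
  moreover have "formula_in L n (\<psi> i j)" for i j
    unfolding \<psi>_def by (rule formula_in_inst_num_3[OF tr \<phi>(1)])
  moreover have "recursive 2 (\<lambda>xs. code (\<psi> (xs ! 0) (xs ! 1)))"
    unfolding \<psi>_def by (rule recursive_code_inst_num_3)
  ultimately show "effectively_n_Rosser R L T n"
    unfolding effectively_n_Rosser_def using I
    by (intro exI[of _ I] exI[of _ "\<lambda>xs. code (\<psi> (xs ! 0) (xs ! 1))"]) auto
qed

lemma Rosser_if_effectively_Rosser:
  assumes R: "acceptable_enumeration R" and T: "effectively_Rosser R L T"
  shows "Rosser L T"
  unfolding Rosser_def
proof (intro allI impI)
  fix n :: nat assume n: "n \<ge> 1"
  then obtain I f where "Num_interp L T I" and f: "\<And>i j. \<exists>\<phi>. f [i, j] = code \<phi> \<and> formula_in L n \<phi> \<and>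
      strongly_separates T I n \<phi> (R n i - R n j) (R n j - R n i)"
    using T unfolding effectively_Rosser_def effectively_n_Rosser_def by blast
  then show "n_Rosser L T n"
    unfolding n_Rosser_def re_iff_index[OF R n] by blast
qed

lemma exact_Rosser_if_effectively_exact_Rosser:
  assumes R: "acceptable_enumeration R" and T: "effectively_exact_Rosser R L T"
  shows "exact_Rosser L T"
  unfolding exact_Rosser_def
proof (intro allI impI)
  fix n :: nat assume n: "n \<ge> 1"
  then obtain I f where "Num_interp L T I" and f: "\<And>i j. R n i \<inter> R n j = {} \<Longrightarrow>
      \<exists>\<phi>. f [i, j] = code \<phi> \<and> formula_in L n \<phi> \<and> exactly_separates T I n \<phi> (R n i) (R n j)"
    using T unfolding effectively_exact_Rosser_def effectively_exact_n_Rosser_def by blast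
  then show "exact_n_Rosser L T n"
    unfolding exact_n_Rosser_def re_iff_index[OF R n] by blast
qed

lemma Rosser_if_exact_Rosser:
  assumes T: "exact_Rosser L T"
  shows "Rosser L T"
  unfolding Rosser_def
proof (intro allI impI)
  fix n :: nat assume n: "n \<ge> 1"
  then obtain I where I: "Num_interp L T I" and sep: "\<And>M1 M2. re n M1 \<Longrightarrow> re n M2 \<Longrightarrow> M1 \<inter> M2 = {} \<Longrightarrow>
      \<exists>\<phi>. formula_in L n \<phi> \<and> exactly_separates T I n \<phi> M1 M2"
    using T unfolding exact_Rosser_def exact_n_Rosser_def by blast
  have "\<exists>\<phi>. formula_in L n \<phi> \<and> strongly_separates T I n \<phi> (M1 - M2) (M2 - M1)"
    if M: "re n M1" "re n M2" for M1 M2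
  proof -
    obtain N1 N2 where N: "re n N1" "re n N2" "N1 \<inter> N2 = {}" "M1 - M2 \<subseteq> N1" "M2 - M1 \<subseteq> N2"
      using re_reduction[OF M] .
    then show ?thesis
      using sep[OF N(1-3)] unfolding strongly_separates_def exactly_separates_def by blast
  qed
  then show "n_Rosser L T n" unfolding n_Rosser_def using I by blast
qed

lemma consistentD: "consistent T \<Longrightarrow> T \<turnstile> \<phi> \<Longrightarrow> \<not> T \<turnstile> Neg \<phi>"
  unfolding consistent_def by (blast intro: MP)

lemma effectively_exact_Rosser_if_Rosser:
  assumes R: "acceptable_enumeration R" and re: "re_theory L T" and con: "consistent T"
    and T: "Rosser L T"
  shows "effectively_exact_Rosser R L T"
  unfolding effectively_exact_Rosser_def
proof (intro allI impI)
  fix n :: nat assume n: "n \<ge> 1"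
  have "n_Rosser L T (n + 3)" using T by (simp add: Rosser_def)
  then obtain I where I: "Num_interp L T I" and sep: "\<And>M1 M2. re (n + 3) M1 \<Longrightarrow> re (n + 3) M2 \<Longrightarrow>
      \<exists>\<phi>. formula_in L (n + 3) \<phi> \<and> strongly_separates T I (n + 3) \<phi> (M1 - M2) (M2 - M1)"
    unfolding n_Rosser_def by blast
  have tr: "translation_into L I" using I by (simp add: Num_interp_def interprets_Num_def)
  obtain g where g: "recursive 2 g" "\<And>\<phi>. T \<turnstile> \<phi> \<longleftrightarrow> (\<exists>k. g [k, code \<phi>] = 0)"
    using re_theorems[OF re] by blast
  obtain F where F: "recursive (Suc (n + 3)) F"
    "\<And>\<phi> as. length as = n + 3 \<Longrightarrow> F (code \<phi> # as) = code (at_numerals I \<phi> as)"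
    using recursive_code_at_numerals by blast
  define M where "M p h = {zs. length zs = n + 3 \<and>
      (drop 3 zs \<in> R n (zs ! p) \<or> (\<exists>k. g [k, h (F (zs ! 0 # zs))] = 0))}" for p and h :: "nat \<Rightarrow> nat"
  define M1 where "M1 = M 1 (\<lambda>c. c_neg c)"
  define M2 where "M2 = M 2 (\<lambda>c. c)"
  have "re (n + 3) M1" "re (n + 3) M2"
    unfolding M1_def M2_def M_def
    by (intro re_index_or_theorem R n g(1) F(1) recursive_prod_encode recursive_const; simp)+
  then obtain \<phi> where \<phi>: "formula_in L (n + 3) \<phi>"
      "strongly_separates T I (n + 3) \<phi> (M1 - M2) (M2 - M1)"
    using sep by blast
  \<comment> \<open>The self-reference: variable 0 of \<open>\<phi>\<close> receives the numeral of
    the code of \<open>\<phi>\<close>.\<close>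
  define \<psi> where "\<psi> i j = inst_num I j (inst_num I i (inst_num I (code \<phi>) \<phi>))" for i j
  have "exactly_separates T I n (\<psi> i j) (R n i) (R n j)" if disj: "R n i \<inter> R n j = {}" for i j
    unfolding exactly_separates_def
  proof (intro allI impI)
    fix as :: "nat list" assume as: "length as = n"
    let ?zs = "code \<phi> # i # j # as"
    let ?\<theta> = "at_numerals I \<phi> ?zs"
    have zs: "length ?zs = n + 3" using as by simp
    \<comment> \<open>Entry 0 of \<open>?zs\<close> is \<open>code \<phi>\<close>, so
      \<open>F\<close> in the definition of \<open>M\<close> yields the code of
      \<open>?\<theta>\<close> itself.\<close>
    have M1: "?zs \<in> M1 \<longleftrightarrow> as \<in> R n i \<or> T \<turnstile> Neg ?\<theta>"
      using zs F(2)[OF zs, of \<phi>] g(2)[of "Neg ?\<theta>"] by (simp add: M1_def M_def)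
    have M2: "?zs \<in> M2 \<longleftrightarrow> as \<in> R n j \<or> T \<turnstile> ?\<theta>"
      using zs F(2)[OF zs, of \<phi>] g(2)[of ?\<theta>] by (simp add: M2_def M_def)
    have "?zs \<in> M1 - M2 \<longrightarrow> T \<turnstile> ?\<theta>" "?zs \<in> M2 - M1 \<longrightarrow> T \<turnstile> Neg ?\<theta>"
      using \<phi>(2) zs unfolding strongly_separates_def by blast+
    \<comment> \<open>If \<open>as\<close> is in \<open>R n i\<close> and \<open>?\<theta>\<close>
      were unprovable, disjointness would put \<open>?zs\<close> in \<open>M1 - M2\<close>, making
      \<open>?\<theta>\<close> provable. If \<open>?\<theta>\<close> is provable and
      \<open>as\<close> were not in \<open>R n i\<close>, consistency would put \<open>?zs\<close>
      in \<open>M2 - M1\<close>, making \<open>?\<theta>\<close> refutable as well. The other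
      equivalence is symmetric.\<close>
    then have "(as \<in> R n i \<longleftrightarrow> T \<turnstile> ?\<theta>) \<and> (as \<in> R n j \<longleftrightarrow> T \<turnstile> Neg ?\<theta>)"
      using M1 M2 disj consistentD[OF con, of ?\<theta>] by blast
    moreover have "prov_equiv T (at_numerals I (\<psi> i j) as) ?\<theta>"
      unfolding \<psi>_def by (rule at_numerals_inst_num_3[OF tr])
    note this[THEN prov_equiv_provable] this[THEN prov_equiv_refutable]
    ultimately show "(as \<in> R n i \<longleftrightarrow> T \<turnstile> at_numerals I (\<psi> i j) as) \<and>
        (as \<in> R n j \<longleftrightarrow> T \<turnstile> Neg (at_numerals I (\<psi> i j) as))"
      by simp
  qed
  moreover have "formula_in L n (\<psi> i j)" for i j
    unfolding \<psi>_def by (rule formula_in_inst_num_3[OF tr \<phi>(1)])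
  moreover have "recursive 2 (\<lambda>xs. code (\<psi> (xs ! 0) (xs ! 1)))"
    unfolding \<psi>_def by (rule recursive_code_inst_num_3)
  ultimately show "effectively_exact_n_Rosser R L T n"
    unfolding effectively_exact_n_Rosser_def using I
    by (intro exI[of _ I] exI[of _ "\<lambda>xs. code (\<psi> (xs ! 0) (xs ! 1))"]) auto
qed

theorem theorem5p6:
  fixes L :: signature and T :: "fm set" and R :: "nat \<Rightarrow> nat \<Rightarrow> nat list set"
  assumes "acceptable_enumeration R"
    and "re_theory L T"
    and "consistent T"
  shows "(Rosser L T \<longleftrightarrow> effectively_Rosser R L T) \<and>
    (effectively_Rosser R L T \<longleftrightarrow> exact_Rosser L T) \<and>
    (exact_Rosser L T \<longleftrightarrow> effectively_exact_Rosser R L T)"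
  using assms effectively_Rosser_if_Rosser Rosser_if_effectively_Rosser Rosser_if_exact_Rosser
    exact_Rosser_if_effectively_exact_Rosser effectively_exact_Rosser_if_Rosser
  by blast

end
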